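(* Let $\psi_1,\psi_2:\mathfrak{sv}^+\to\mathbb{C}$ be nonsingular Lie algebra homomorphisms (that is, $\psi_i(M_1)\ne 0$ for $i=1,2$) and let $\xi_1,\xi_2\in\mathbb{C}$. Then the $\mathfrak{sv}$-modules $L_{\psi_1,\xi_1}$ and $L_{\psi_2,\xi_2}$ are isomorphic if and only if $\psi_1=\psi_2$ and $\xi_1=\xi_2$.
   Context: The Schrödinger-Virasoro algebra $\mathfrak{sv}$ is the complex Lie algebra with basis $\{L_n,M_n,Y_{n+\frac12}\mid n\in\mathbb{Z}\}$ and brackets, for $m,n\in\mathbb{Z}$: $[L_m,L_n]=(n-m)L_{m+n}$, $[L_m,M_n]=nM_{m+n}$, $[L_m,Y_{n+\frac12}]=(n+\frac{1-m}{2})Y_{m+n+\frac12}$, $[Y_{m+\frac12},Y_{n+\frac12}]=(n-m)M_{m+n+1}$, $[M_m,M_n]=[M_m,Y_{n+\frac12}]=0$. The element $M_0$ is central. Put $\mathfrak{sv}^+=\mathrm{span}_{\mathbb{C}}\{L_n,M_n,Y_{m+\frac12}\mid n\geq 1,\ m\geq 0\}$. All Lie algebra homomorphisms $\psi:\mathfrak{sv}^+\to\mathbb{C}$ considered satisfy $\psi(L_n)=0$ for $n\geq 3$, $\psi(M_m)=0$ for $m\geq 2$, and $\psi(Y_{\frac12+k})=0$ for $k\geq 1$. For such $\psi$ let $\mathbb{C}_\psi$ be the one-dimensional $\mathfrak{sv}^+$-module with $x\alpha=\psi(x)\alpha$, let $W_\psi=U(\mathfrak{sv})\otimes_{U(\mathfrak{sv}^+)}\mathbb{C}_\psi$,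 and for $\xi\in\mathbb{C}$ let $L_{\psi,\xi}=W_\psi/(M_0-\xi)W_\psi$. *)

theory Defs
  imports Complex_Main "HOL-Library.Poly_Mapping" "HOL-Algebra.QuotRing" "HOL-Algebra.Module"
    "HOL-Algebra.Free_Abelian_Groups"
begin

section \<open>Free complex vector spaces\<close>

definition pm_scale :: "complex \<Rightarrow> ('a \<Rightarrow>\<^sub>0 complex) \<Rightarrow> ('a \<Rightarrow>\<^sub>0 complex)" where
  "pm_scale c p = Poly_Mapping.map ((*) c) p"

lemma lookup_pm_scale [simp]: "Poly_Mapping.lookup (pm_scale c p) i = c * Poly_Mapping.lookup p i"
  by (simp add: pm_scale_def Poly_Mapping.map.rep_eq when_def)

interpretation pm: vector_space "pm_scale :: complex \<Rightarrow> ('a \<Rightarrow>\<^sub>0 complex) \<Rightarrow> _"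
  by unfold_locales (auto intro!: poly_mapping_eqI simp: lookup_add algebra_simps)

section \<open>The Schroedinger-Virasoro algebra\<close>

text \<open>The basis vector \<open>Ygen n\<close> stands for \<open>Y\<^bsub>n+1/2\<^esub>\<close>.\<close>

datatype sv_index = Lgen int | Mgen int | Ygen int

type_synonym sv = "sv_index \<Rightarrow>\<^sub>0 complex"

definition basis :: "sv_index \<Rightarrow> sv" where
  "basis i = Poly_Mapping.single i 1"

fun basis_bracket :: "sv_index \<Rightarrow> sv_index \<Rightarrow> sv" where
  "basis_bracket (Lgen m) (Lgen n) = pm_scale (of_int (n - m)) (basis (Lgen (m + n)))"
| "basis_bracket (Lgen m) (Mgen n) = pm_scale (of_int n) (basis (Mgen (m + n)))"
| "basis_bracket (Mgen n) (Lgen m) = - pm_scale (of_int n) (basis (Mgen (m + n)))"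
| "basis_bracket (Lgen m) (Ygen n) = pm_scale (of_int n + (1 - of_int m) / 2) (basis (Ygen (m + n)))"
| "basis_bracket (Ygen n) (Lgen m) = - pm_scale (of_int n + (1 - of_int m) / 2) (basis (Ygen (m + n)))"
| "basis_bracket (Ygen m) (Ygen n) = pm_scale (of_int (n - m)) (basis (Mgen (m + n + 1)))"
| "basis_bracket (Mgen m) (Mgen n) = 0"
| "basis_bracket (Mgen m) (Ygen n) = 0"
| "basis_bracket (Ygen n) (Mgen m) = 0"

definition bracket :: "sv \<Rightarrow> sv \<Rightarrow> sv" where
  "bracket x y = (\<Sum>i\<in>Poly_Mapping.keys x. \<Sum>j\<in>Poly_Mapping.keys y.
     pm_scale (Poly_Mapping.lookup x i * Poly_Mapping.lookup y j) (basis_bracket i j))"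

definition sv_plus :: "sv set" where
  "sv_plus = pm.span (basis ` ({Lgen n | n. n \<ge> 1} \<union> {Mgen n | n. n \<ge> 1} \<union> {Ygen m | m. m \<ge> 0}))"

text \<open>A Lie algebra homomorphism from \<open>sv_plus\<close> to the abelian Lie algebra \<open>\<complex>\<close>; only the
  values on \<open>sv_plus\<close> are meaningful.\<close>

definition lie_hom_plus :: "(sv \<Rightarrow> complex) \<Rightarrow> bool" where
  "lie_hom_plus \<psi> \<longleftrightarrow>
     (\<forall>x\<in>sv_plus. \<forall>y\<in>sv_plus. \<psi> (x + y) = \<psi> x + \<psi> y) \<and>
     (\<forall>c. \<forall>x\<in>sv_plus. \<psi> (pm_scale c x) = c * \<psi> x) \<and>
     (\<forall>x\<in>sv_plus. \<forall>y\<in>sv_plus. \<psi> (bracket x y) = 0)"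

definition admissible :: "(sv \<Rightarrow> complex) \<Rightarrow> bool" where
  "admissible \<psi> \<longleftrightarrow> lie_hom_plus \<psi> \<and>
     (\<forall>n\<ge>3. \<psi> (basis (Lgen n)) = 0) \<and>
     (\<forall>m\<ge>2. \<psi> (basis (Mgen m)) = 0) \<and>
     (\<forall>k\<ge>1. \<psi> (basis (Ygen k)) = 0)"

definition nonsingular :: "(sv \<Rightarrow> complex) \<Rightarrow> bool" where
  "nonsingular \<psi> \<longleftrightarrow> \<psi> (basis (Mgen 1)) \<noteq> 0"

lemma bracket_add_left: "bracket (x + y) z = bracket x z + bracket y z"
proof -
  define K where "K = Poly_Mapping.keys x \<union> Poly_Mapping.keys y"
  have *: "bracket w z = (\<Sum>i\<in>K. \<Sum>j\<in>Poly_Mapping.keys z.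
      pm_scale (Poly_Mapping.lookup w i * Poly_Mapping.lookup z j) (basis_bracket i j))"
    if "Poly_Mapping.keys w \<subseteq> K" for w
    unfolding bracket_def using that
    by (intro sum.mono_neutral_left) (auto simp: K_def in_keys_iff)
  show ?thesis
    by (subst (1 2 3) *) (use Poly_Mapping.keys_add[of x y] in
        \<open>auto simp: K_def lookup_add distrib_right pm.scale_left_distrib sum.distrib\<close>)
qed

lemma bracket_add_right: "bracket z (x + y) = bracket z x + bracket z y"
proof -
  define K where "K = Poly_Mapping.keys x \<union> Poly_Mapping.keys y"
  have *: "bracket z w = (\<Sum>i\<in>Poly_Mapping.keys z. \<Sum>j\<in>K.
      pm_scale (Poly_Mapping.lookup z i * Poly_Mapping.lookup w j) (basis_bracket i j))"
    if "Poly_Mapping.keys w \<subseteq> K" for w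
    unfolding bracket_def using that
    by (intro sum.cong refl sum.mono_neutral_left) (auto simp: K_def in_keys_iff)
  show ?thesis
    by (subst (1 2 3) *) (use Poly_Mapping.keys_add[of x y] in
        \<open>auto simp: K_def lookup_add distrib_left pm.scale_left_distrib sum.distrib\<close>)
qed

lemma bracket_zero [simp]: "bracket 0 y = 0" "bracket x 0 = 0"
  by (simp_all add: bracket_def)

lemma bracket_single:
  "bracket (Poly_Mapping.single i a) (Poly_Mapping.single j b) = pm_scale (a * b) (basis_bracket i j)"
  by (cases "a = 0"; cases "b = 0") (simp_all add: bracket_def)

lemma bracket_scale_left: "bracket (pm_scale c x) y = pm_scale c (bracket x y)"
proof (cases "c = 0")
  case False
  then have "Poly_Mapping.keys (pm_scale c x) = Poly_Mapping.keys x"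
    by (auto simp: in_keys_iff)
  then show ?thesis
    by (simp add: bracket_def pm.scale_sum_right mult.assoc)
qed simp

lemma bracket_scale_right: "bracket x (pm_scale c y) = pm_scale c (bracket x y)"
proof (cases "c = 0")
  case False
  then have "Poly_Mapping.keys (pm_scale c y) = Poly_Mapping.keys y"
    by (auto simp: in_keys_iff)
  then show ?thesis
    by (simp add: bracket_def pm.scale_sum_right mult_ac)
qed simp

lemma sv_expand: "x = (\<Sum>i\<in>Poly_Mapping.keys x. pm_scale (Poly_Mapping.lookup x i) (basis i))"
  by (rule poly_mapping_eqI)
    (auto simp: Poly_Mapping.lookup_sum basis_def lookup_single when_def in_keys_iff if_distrib
        cong: if_cong)

lemma sv_induct [case_names zero scale add]:
  assumes "P 0" "\<And>c i. P (pm_scale c (basis i))" "\<And>x y. P x \<Longrightarrow> P y \<Longrightarrow> P (x + y)"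
  shows "P (x :: sv)"
proof -
  have "P (\<Sum>i\<in>K. pm_scale (Poly_Mapping.lookup x i) (basis i))" if "finite K" for K
    using that by induction (auto intro: assms)
  from this[of "Poly_Mapping.keys x"] show ?thesis
    using sv_expand[of x] by simp
qed

lemma bracket_basis [simp]: "bracket (basis i) (basis j) = basis_bracket i j"
  by (simp add: basis_def bracket_single)

lemma bracket_uminus_left: "bracket (- x) y = - bracket x y"
  and bracket_uminus_right: "bracket y (- x) = - bracket y x"
  using bracket_scale_left[of "-1" x y] bracket_scale_right[of y "-1" x]
  by simp_all

lemmas bracket_linear = bracket_add_left bracket_add_right bracket_scale_left
  bracket_scale_right bracket_uminus_left bracket_uminus_right

lemma bracket_antisym: "bracket x y = - bracket y x"
proof (induction x rule: sv_induct)
  case (scale c i)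
  show ?case
  proof (induction y rule: sv_induct)
    case (scale d j)
    have "basis_bracket i j = - basis_bracket j i"
      by (cases i; cases j) (auto intro!: poly_mapping_eqI simp: add_ac algebra_simps)
    then show ?case
      by (simp add: bracket_linear mult.commute)
  qed (simp_all add: bracket_linear pm.scale_right_distrib)
qed (simp_all add: bracket_linear)

lemma bracket_jacobi:
  "bracket x (bracket y z) + bracket y (bracket z x) + bracket z (bracket x y) = 0"
proof -
  define J where "J x y z = bracket x (bracket y z) + bracket y (bracket z x)
    + bracket z (bracket x y)" for x y z
  have J_add: "J (x + x') y z = J x y z + J x' y z" "J x (y + y') z = J x y z + J x y' z"
    "J x y (z + z') = J x y z + J x y z'" for x x' y y' z z'
    by (simp_all add: J_def bracket_linear)
  have J_scale: "J (pm_scale c x) y z = pm_scale c (J x y z)"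
    "J x (pm_scale c y) z = pm_scale c (J x y z)" "J x y (pm_scale c z) = pm_scale c (J x y z)"
    for c x y z
    by (simp_all add: J_def bracket_linear pm.scale_right_distrib)
  have J_zero: "J 0 y z = 0" "J x 0 z = 0" "J x y 0 = 0" for x y z
    by (simp_all add: J_def)
  have J_basis: "J (basis i) (basis j) (basis k) = 0" for i j k
    by (cases i; cases j; cases k)
      (simp_all add: J_def bracket_linear poly_mapping_eq_iff fun_eq_iff lookup_add lookup_minus
          lookup_uminus add_ac,
        simp_all add: field_simps)
  have "J x y z = 0"
  proof (induction x rule: sv_induct)
    case (scale a i)
    have "J (basis i) y z = 0"
    proof (induction y rule: sv_induct)
      case (scale b j)
      have "J (basis i) (basis j) z = 0"
        by (induction z rule: sv_induct) (simp_all add: J_add J_scale J_zero J_basis)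
      then show ?case by (simp add: J_scale)
    qed (simp_all add: J_add J_zero)
    then show ?case by (simp add: J_scale)
  qed (simp_all add: J_add J_zero)
  then show ?thesis by (simp add: J_def)
qed

lemma sv_plus_bracket_closed:
  assumes "x \<in> sv_plus" "y \<in> sv_plus"
  shows "bracket x y \<in> sv_plus"
proof -
  let ?B = "basis ` ({Lgen n | n. n \<ge> 1} \<union> {Mgen n | n. n \<ge> 1} \<union> {Ygen m | m. m \<ge> 0})"
  have base: "bracket u v \<in> pm.span ?B" if "u \<in> ?B" "v \<in> ?B" for u v
    using that
    by (auto intro!: pm.span_scale pm.span_neg pm.span_zero, auto intro!: pm.span_base imageI)
  have gen_left: "bracket u y \<in> pm.span ?B" if "u \<in> ?B" for u
    using assms(2) unfolding sv_plus_def
  proof (induction rule: pm.span_induct_alt)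
    case (step c v y)
    then show ?case
      by (simp only: bracket_linear) (rule pm.span_add[OF pm.span_scale[OF base[OF that]]])
  qed (simp add: pm.span_zero)
  show ?thesis
    using assms(1) unfolding sv_plus_def
  proof (induction rule: pm.span_induct_alt)
    case (step c u x)
    then show ?case
      by (simp only: bracket_linear) (rule pm.span_add[OF pm.span_scale[OF gen_left]])
  qed (simp add: pm.span_zero)
qed

section \<open>Universal enveloping algebras\<close>

text \<open>Words form a monoid under concatenation, so that \<open>'g word \<Rightarrow>\<^sub>0 complex\<close> with its
  convolution product is the free unital associative complex algebra on the type \<open>'g\<close>.\<close>

datatype 'g word = Word (letters: "'g list")

instantiation word :: (type) monoid_add
begin

definition zero_word :: "'a word" where "zero_word = Word []"

definition plus_word :: "'a word \<Rightarrow> 'a word \<Rightarrow> 'a word" where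
  "plus_word v w = Word (letters v @ letters w)"

instance
  by standard (simp_all add: zero_word_def plus_word_def)

end

type_synonym 'g free_alg = "'g word \<Rightarrow>\<^sub>0 complex"

definition gen :: "'g \<Rightarrow> 'g free_alg" where
  "gen x = Poly_Mapping.single (Word [x]) 1"

definition free_alg :: "'g set \<Rightarrow> 'g free_alg ring" where
  "free_alg S = \<lparr>carrier = {p. \<forall>w\<in>Poly_Mapping.keys p. set (letters w) \<subseteq> S},
     mult = (*), one = 1, ring.zero = 0, ring.add = (+)\<rparr>"

lemma ring_free_alg: "ring (free_alg S)"
proof (rule ringI)
  show "abelian_group (free_alg S)"
  proof (rule abelian_groupI)
    fix p assume "p \<in> carrier (free_alg S)"
    then show "\<exists>q\<in>carrier (free_alg S). q \<oplus>\<^bsub>free_alg S\<^esub> p = \<zero>\<^bsub>free_alg S\<^esub>"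
      by (intro bexI[of _ "- p"]) (auto simp: free_alg_def)
  qed (use Poly_Mapping.keys_add in \<open>fastforce simp: free_alg_def add_ac\<close>)+
  show "Group.monoid (free_alg S)"
  proof (rule monoidI)
    fix p q assume "p \<in> carrier (free_alg S)" "q \<in> carrier (free_alg S)"
    then show "p \<otimes>\<^bsub>free_alg S\<^esub> q \<in> carrier (free_alg S)"
      using Poly_Mapping.keys_mult[of p q] by (fastforce simp: free_alg_def plus_word_def)
  qed (auto simp: free_alg_def mult.assoc zero_word_def)
qed (auto simp: free_alg_def algebra_simps)

text \<open>For a Lie subalgebra \<open>S\<close> of \<open>sv\<close>, \<open>U(S)\<close> is the free algebra on the set \<open>S\<close> modulo the
  relations saying that \<open>S \<rightarrow> U(S)\<close> is linear (which yields the tensor algebra of \<open>S\<close>) and that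
  the bracket becomes the commutator.\<close>

definition env_rels :: "sv set \<Rightarrow> sv free_alg set" where
  "env_rels S =
     {gen (x + y) - gen x - gen y | x y. x \<in> S \<and> y \<in> S} \<union>
     {gen (pm_scale c x) - pm_scale c (gen x) | c x. x \<in> S} \<union>
     {gen x * gen y - gen y * gen x - gen (bracket x y) | x y. x \<in> S \<and> y \<in> S}"

definition env_ideal :: "sv set \<Rightarrow> sv free_alg set" where
  "env_ideal S = genideal (free_alg S) (env_rels S)"

definition env :: "sv set \<Rightarrow> sv free_alg set ring" where
  "env S = free_alg S Quot env_ideal S"

definition env_class :: "sv set \<Rightarrow> sv free_alg \<Rightarrow> sv free_alg set" where
  "env_class S p = env_ideal S +>\<^bsub>free_alg S\<^esub> p"

definition env_gen :: "sv set \<Rightarrow> sv \<Rightarrow> sv free_alg set" where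
  "env_gen S x = env_class S (gen x)"

definition env_scalar :: "sv set \<Rightarrow> complex \<Rightarrow> sv free_alg set" where
  "env_scalar S c = env_class S (pm_scale c 1)"

text \<open>The canonical homomorphism \<open>U(S) \<rightarrow> U(sv)\<close> sends the class of a noncommutative polynomial
  over \<open>S\<close> to its class over \<open>sv\<close>.\<close>

definition env_incl :: "sv free_alg set \<Rightarrow> sv free_alg set" where
  "env_incl X = (\<Union>p\<in>X. env_class UNIV p)"

abbreviation U_sv :: "sv free_alg set ring" where "U_sv \<equiv> env UNIV"

abbreviation U_sv_plus :: "sv free_alg set ring" where "U_sv_plus \<equiv> env sv_plus"

section \<open>Modules\<close>

text \<open>Left modules over a not necessarily commutative ring are represented by records of the
  library type \<^typ>\<open>('r, 'm) module\<close>, whose fields \<open>mult\<close> and \<open>one\<close> carry no meaning here.\<close>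

definition quot_module :: "('r, 'm, 'e) module_scheme \<Rightarrow> 'm set \<Rightarrow> ('r, 'm set) module" where
  "quot_module M N = \<lparr>carrier = a_rcosets\<^bsub>M\<^esub> N, mult = undefined, one = undefined,
     ring.zero = N, ring.add = set_add M, smult = (\<lambda>r X. \<Union>x\<in>X. N +>\<^bsub>M\<^esub> (r \<odot>\<^bsub>M\<^esub> x))\<rparr>"

text \<open>The tensor product over \<open>R\<close> of a ring \<open>A\<close>, which is a right \<open>R\<close>-module through \<open>h : R \<rightarrow> A\<close>,
  with a left \<open>R\<close>-module \<open>B\<close>: the free abelian group on \<open>A \<times> B\<close> modulo the biadditivity and
  balancing relations, on which \<open>A\<close> acts by \<open>a \<cdot> (a' \<otimes> b) = a a' \<otimes> b\<close>.\<close>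

definition tensor_rels ::
    "('r, 'c) ring_scheme \<Rightarrow> ('a, 'd) ring_scheme \<Rightarrow> ('r \<Rightarrow> 'a) \<Rightarrow> ('r, 'b, 'e) module_scheme
      \<Rightarrow> ('a \<times> 'b \<Rightarrow>\<^sub>0 int) set" where
  "tensor_rels R A h B =
     {frag_of (a \<oplus>\<^bsub>A\<^esub> a', b) - frag_of (a, b) - frag_of (a', b) | a a' b.
        a \<in> carrier A \<and> a' \<in> carrier A \<and> b \<in> carrier B} \<union>
     {frag_of (a, b \<oplus>\<^bsub>B\<^esub> b') - frag_of (a, b) - frag_of (a, b') | a b b'.
        a \<in> carrier A \<and> b \<in> carrier B \<and> b' \<in> carrier B} \<union>
     {frag_of (a \<otimes>\<^bsub>A\<^esub> h r, b) - frag_of (a, r \<odot>\<^bsub>B\<^esub> b) | a r b.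
        a \<in> carrier A \<and> r \<in> carrier R \<and> b \<in> carrier B}"

text \<open>Left multiplication by \<open>a\<close> is extended additively to formal sums; this becomes a module
  action only after dividing by the relations.\<close>

definition pretensor ::
    "('a, 'd) ring_scheme \<Rightarrow> ('r, 'b, 'e) module_scheme \<Rightarrow> ('a, 'a \<times> 'b \<Rightarrow>\<^sub>0 int) module" where
  "pretensor A B = \<lparr>carrier = carrier (free_Abelian_group (carrier A \<times> carrier B)),
     mult = undefined, one = undefined, ring.zero = 0, ring.add = (+),
     smult = (\<lambda>a. frag_extend (\<lambda>(a', b). frag_of (a \<otimes>\<^bsub>A\<^esub> a', b)))\<rparr>"

definition tensor ::
    "('r, 'c) ring_scheme \<Rightarrow> ('a, 'd) ring_scheme \<Rightarrow> ('r \<Rightarrow> 'a) \<Rightarrow> ('r, 'b, 'e) module_scheme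
      \<Rightarrow> ('a, ('a \<times> 'b \<Rightarrow>\<^sub>0 int) set) module" where
  "tensor R A h B = quot_module (pretensor A B)
     (generate (free_Abelian_group (carrier A \<times> carrier B)) (tensor_rels R A h B))"

text \<open>\<open>psi_ext \<psi>\<close> is the extension of \<open>\<psi>\<close> to the free algebra. When \<open>\<psi>\<close> is a Lie algebra
  homomorphism it is constant on each class in \<open>U(sv_plus)\<close>.\<close>

definition psi_ext :: "(sv \<Rightarrow> complex) \<Rightarrow> sv free_alg \<Rightarrow> complex" where
  "psi_ext \<psi> p = (\<Sum>w\<in>Poly_Mapping.keys p. Poly_Mapping.lookup p w * prod_list (map \<psi> (letters w)))"

definition C_mod :: "(sv \<Rightarrow> complex) \<Rightarrow> (sv free_alg set, complex) module" where
  "C_mod \<psi> = \<lparr>carrier = UNIV, mult = (*), one = 1, ring.zero = 0, ring.add = (+),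
     smult = (\<lambda>X \<alpha>. the_elem (psi_ext \<psi> ` X) * \<alpha>)\<rparr>"

type_synonym W_elem = "(sv free_alg set \<times> complex \<Rightarrow>\<^sub>0 int) set"

definition W_mod :: "(sv \<Rightarrow> complex) \<Rightarrow> (sv free_alg set, W_elem) module" where
  "W_mod \<psi> = tensor U_sv_plus U_sv env_incl (C_mod \<psi>)"

definition M0_minus :: "complex \<Rightarrow> sv free_alg set" where
  "M0_minus \<xi> = env_gen UNIV (basis (Mgen 0)) \<ominus>\<^bsub>U_sv\<^esub> env_scalar UNIV \<xi>"

definition L_mod :: "(sv \<Rightarrow> complex) \<Rightarrow> complex \<Rightarrow> (sv free_alg set, W_elem set) module" where
  "L_mod \<psi> \<xi> = quot_module (W_mod \<psi>)
     ((\<lambda>w. M0_minus \<xi> \<odot>\<^bsub>W_mod \<psi>\<^esub> w) ` carrier (W_mod \<psi>))"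

text \<open>An \<open>sv\<close>-module isomorphism is a complex linear bijection commuting with the action of
  \<open>sv\<close>; scalars and elements of \<open>sv\<close> act through \<open>U(sv)\<close>.\<close>

definition sv_iso ::
    "(sv free_alg set, 'v, 'd) module_scheme \<Rightarrow> (sv free_alg set, 'w, 'e) module_scheme \<Rightarrow> bool" where
  "sv_iso V W \<longleftrightarrow> (\<exists>f \<in> iso (add_monoid V) (add_monoid W).
     (\<forall>c. \<forall>v\<in>carrier V. f (env_scalar UNIV c \<odot>\<^bsub>V\<^esub> v) = env_scalar UNIV c \<odot>\<^bsub>W\<^esub> f v) \<and>
     (\<forall>x. \<forall>v\<in>carrier V. f (env_gen UNIV x \<odot>\<^bsub>V\<^esub> v) = env_gen UNIV x \<odot>\<^bsub>W\<^esub> f v))"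

end

theory Submission
  imports Defs
begin

text \<open>
  Call a vector \<open>v\<close> of a module a Whittaker vector of type \<open>\<psi>\<close> if every \<open>x\<close> in \<open>sv_plus\<close> acts on it
  by \<open>\<psi> x\<close>. The module with parameters \<open>\<psi>\<close>, \<open>\<xi>\<close> is generated by such a vector, and \<open>M\<^sub>0\<close> acts on it
  by \<open>\<xi>\<close>. Two facts show that the parameters can be read off from the module.

  First, the type of a nonzero Whittaker vector is unique. For a basis element \<open>x\<close> of positive degree
  the operator \<open>x - \<psi> x\<close> is locally nilpotent on the module (\<open>locally_nilpotent\<close>): commuting \<open>x\<close> past
  a word of basis elements raises the degree of one letter, and a letter of positive degree can be
  moved to the right end, where it becomes a scalar and the word becomes shorter. If \<open>x\<close> acts on a
  nonzero vector by \<open>c\<close>, then some power of \<open>c - \<psi> x\<close> annihilates it, so \<open>c = \<psi> x\<close>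
  (\<open>eigenvalue_unique\<close>). An isomorphism carries a generating Whittaker vector of type \<open>\<psi>1\<close> to a nonzero
  Whittaker vector of type \<open>\<psi>1\<close> in a module with parameter \<open>\<psi>2\<close>; hence \<open>\<psi>1 = \<psi>2\<close>, and comparing the
  scalars by which \<open>M\<^sub>0\<close> acts gives \<open>\<xi>1 = \<xi>2\<close>.

  Second, the modules are not zero (\<open>L_proj_one\<close>); zero modules would carry no parameters. This
  is a form of the Poincare-Birkhoff-Witt theorem. Words in the basis of \<open>sv\<close> are rewritten by
  sorting adjacent letters at the cost of a commutator, and by replacing a last letter from
  \<open>sv_plus\<close> or equal to \<open>M\<^sub>0\<close> by its scalar. By the diamond lemma the coefficient of the empty word
  in the result is independent of the order of the steps (\<open>all_consistent\<close>). It defines a linear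
  functional on the enveloping algebra (\<open>whittaker_functional\<close>) that takes the value 1 at 1 and respects
  all relations of the module.

  Both arguments are carried out with noncommutative polynomials: the module is the image of the
  free algebra on \<open>sv\<close> under an explicit projection (\<open>L_proj\<close>), so it is determined by a left ideal
  of the free algebra (\<open>whittaker_kernel\<close>). Conversely, equal parameters give literally equal
  modules, since the construction evaluates \<open>\<psi>\<close> only on \<open>sv_plus\<close>.
\<close>

section \<open>Additive extension of functions\<close>

lemma single_add_induct [case_names single add]:
  assumes "\<And>k c. P (Poly_Mapping.single k c)" "\<And>p q. P p \<Longrightarrow> P q \<Longrightarrow> P (p + q)"
  shows "P (p :: 'k \<Rightarrow>\<^sub>0 'c::comm_monoid_add)"
proof (induction p rule: update_induct)
  case const
  then show ?case using assms(1)[of _ 0] by simp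
next
  case (update p k c)
  then have "Poly_Mapping.update k c p = Poly_Mapping.single k c + p"
    by (intro poly_mapping_eqI) (auto simp: update.rep_eq lookup_add lookup_single in_keys_iff)
  with update assms show ?case by simp
qed

lemma poly_mapping_expand:
  "p = (\<Sum>k\<in>Poly_Mapping.keys p. Poly_Mapping.single k (Poly_Mapping.lookup p k))"
  by (rule poly_mapping_eqI) (simp add: Poly_Mapping.lookup_sum lookup_single when_def in_keys_iff)

definition additive_ext :: "('k \<Rightarrow> 'c::ab_group_add \<Rightarrow> 'v::ab_group_add) \<Rightarrow> ('k \<Rightarrow>\<^sub>0 'c) \<Rightarrow> 'v" where
  "additive_ext g p = (\<Sum>k\<in>Poly_Mapping.keys p. g k (Poly_Mapping.lookup p k))"

lemma additive_ext_superset: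
  assumes "finite K" "Poly_Mapping.keys p \<subseteq> K" "\<And>k. g k 0 = 0"
  shows "additive_ext g p = (\<Sum>k\<in>K. g k (Poly_Mapping.lookup p k))"
  unfolding additive_ext_def using assms by (intro sum.mono_neutral_left) (auto simp: in_keys_iff)

lemma additive_ext_zero [simp]: "additive_ext g 0 = 0"
  by (simp add: additive_ext_def)

lemma additive_ext_single:
  assumes "g k 0 = 0"
  shows "additive_ext g (Poly_Mapping.single k c) = g k c"
  using assms by (cases "c = 0") (simp_all add: additive_ext_def)

lemma additive_ext_add:
  assumes "\<And>k a b. g k (a + b) = g k a + g k b"
  shows "additive_ext g (p + q) = additive_ext g p + additive_ext g q"
proof -
  define K where "K = Poly_Mapping.keys p \<union> Poly_Mapping.keys q"
  have "g k 0 = 0" for k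
    using assms[of k 0 0] by simp
  then have *: "additive_ext g r = (\<Sum>k\<in>K. g k (Poly_Mapping.lookup r k))"
    if "Poly_Mapping.keys r \<subseteq> K" for r
    using that by (intro additive_ext_superset) (auto simp: K_def)
  show ?thesis
    by (subst (1 2 3) *) (use Poly_Mapping.keys_add[of p q] in
        \<open>auto simp: K_def lookup_add assms sum.distrib\<close>)
qed

lemma additive_diff:
  fixes F :: "'a::ab_group_add \<Rightarrow> 'b::ab_group_add"
  assumes "\<And>p q. F (p + q) = F p + F q"
  shows "F (p - q) = F p - F q"
  using assms[of "p - q" q] by simp

lemma additive_zero:
  assumes "\<And>p q. F (p + q) = F p + F q"
  shows "F (0 :: 'a::ab_group_add) = (0 :: 'b::ab_group_add)"
  using assms[of 0 0] by simp

abbreviation scalar :: "complex \<Rightarrow> ('k::monoid_add \<Rightarrow>\<^sub>0 complex)" where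
  "scalar c \<equiv> Poly_Mapping.single 0 c"

lemma pm_scale_single [simp]: "pm_scale c (Poly_Mapping.single k a) = Poly_Mapping.single k (c * a)"
  by (rule poly_mapping_eqI) (simp add: lookup_single when_def)

lemma scalar_mult: "scalar c * r = pm_scale c (r :: 'k::monoid_add \<Rightarrow>\<^sub>0 complex)"
  by (induction r rule: single_add_induct)
      (simp_all add: mult_single pm.scale_right_distrib distrib_left)

lemma mult_scalar: "r * scalar c = pm_scale c (r :: 'k::monoid_add \<Rightarrow>\<^sub>0 complex)"
  by (induction r rule: single_add_induct)
      (simp_all add: mult_single pm.scale_right_distrib distrib_right mult.commute)

lemma pm_scale_mult_left [simp]: "pm_scale c p * q = pm_scale c (p * q :: 'k::monoid_add \<Rightarrow>\<^sub>0 complex)"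
  by (metis mult.assoc scalar_mult)

lemma pm_scale_mult_right [simp]: "p * pm_scale c q = pm_scale c (p * q :: 'k::monoid_add \<Rightarrow>\<^sub>0 complex)"
  by (metis mult.assoc mult_scalar)

definition linear_ext :: "('k \<Rightarrow> complex) \<Rightarrow> ('k \<Rightarrow>\<^sub>0 complex) \<Rightarrow> complex" where
  "linear_ext f = additive_ext (\<lambda>k c. c * f k)"

lemma linear_ext_single [simp]: "linear_ext f (Poly_Mapping.single k c) = c * f k"
  by (simp add: linear_ext_def additive_ext_single)

lemma linear_ext_add [simp]: "linear_ext f (p + q) = linear_ext f p + linear_ext f q"
  by (simp add: linear_ext_def additive_ext_add distrib_right)

lemma linear_ext_zero [simp]: "linear_ext f 0 = 0"
  by (simp add: linear_ext_def)

lemma linear_ext_diff [simp]: "linear_ext f (p - q) = linear_ext f p - linear_ext f q"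
  by (rule additive_diff) simp

lemma linear_ext_scale [simp]: "linear_ext f (pm_scale c p) = c * linear_ext f p"
  by (induction p rule: single_add_induct)
    (simp_all add: pm.scale_right_distrib distrib_left)

section \<open>Monomials in free algebras\<close>

definition monomial :: "'g list \<Rightarrow> 'g free_alg" where
  "monomial w = Poly_Mapping.single (Word w) 1"

lemma monomial_Nil [simp]: "monomial [] = 1"
  by (simp add: monomial_def flip: zero_word_def single_one)

lemma monomial_append: "monomial (u @ v) = monomial u * monomial v"
  by (simp add: monomial_def mult_single plus_word_def)

lemma monomial_Cons: "monomial (i # v) = gen i * monomial v"
  by (simp add: monomial_def gen_def mult_single plus_word_def)

definition emb :: "sv \<Rightarrow> sv_index free_alg" where
  "emb = additive_ext (\<lambda>i c. Poly_Mapping.single (Word [i]) c)"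

lemma emb_add [simp]: "emb (x + y) = emb x + emb y"
  by (simp add: emb_def additive_ext_add single_add)

lemma emb_zero [simp]: "emb 0 = 0"
  by (simp add: emb_def)

lemma emb_single [simp]: "emb (Poly_Mapping.single i c) = pm_scale c (gen i)"
  by (simp add: emb_def additive_ext_single gen_def)

lemma emb_basis [simp]: "emb (basis i) = gen i"
  by (simp add: basis_def)

lemma emb_scale [simp]: "emb (pm_scale c x) = pm_scale c (emb x)"
  by (induction x rule: single_add_induct)
    (simp_all add: pm.scale_right_distrib)

lemma emb_diff [simp]: "emb (x - y) = emb x - emb y"
  by (rule additive_diff) simp

section \<open>Normal ordering of words modulo a character of a subalgebra\<close>

instance sv_index :: countable by countable_datatype

text \<open>
  \<open>H\<close> is the index set of a subalgebra spanned by basis vectors, and \<open>\<chi>\<close> lists the values of a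
  character of it on these vectors. The aim is a linear functional on words that vanishes on the
  relations of the module induced from this character, and not at the empty word.
\<close>

locale induced_character =
  fixes H :: "sv_index set" and \<chi> :: "sv_index \<Rightarrow> complex"
  assumes keys_bracket: "i \<in> H \<Longrightarrow> j \<in> H \<Longrightarrow> Poly_Mapping.keys (basis_bracket i j) \<subseteq> H"
    and char_bracket: "i \<in> H \<Longrightarrow> j \<in> H \<Longrightarrow> linear_ext \<chi> (basis_bracket i j) = 0"
begin

text \<open>
  The letters are ordered by an injection into the integers that puts \<open>H\<close> above its complement, so
  that sorting a word moves letters from \<open>H\<close> to the right end, where they act by \<open>\<chi>\<close>.
\<close>

definition key :: "sv_index \<Rightarrow> int" where
  "key i = (if i \<in> H then int (to_nat i) else - 1 - int (to_nat i))"

lemma key_inj: "key i = key j \<Longrightarrow> i = j"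
  by (auto simp: key_def split: if_splits)

lemma key_H: "j \<in> H \<Longrightarrow> key j < key i \<Longrightarrow> i \<in> H"
  by (auto simp: key_def split: if_splits)

fun inversions :: "sv_index list \<Rightarrow> nat" where
  "inversions [] = 0"
| "inversions (i # w) = length (filter (\<lambda>j. key j < key i) w) + inversions w"

lemma inversions_swap: "key j < key i \<Longrightarrow> inversions (u @ j # i # v) < inversions (u @ i # j # v)"
  by (induction u) auto

definition descent :: "sv_index list \<Rightarrow> sv_index list \<Rightarrow> sv_index \<Rightarrow> sv_index \<Rightarrow> sv_index list \<Rightarrow> bool"
  where "descent w u i j v \<longleftrightarrow> w = u @ i # j # v \<and> key j < key i"

text \<open>
  The coefficient of the empty word in the normal form of \<open>w\<close>. At each step one arbitrarily chosen
  descent is removed; swapping it decreases the number of inversions, and the commutator term is a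
  shorter word. A nonempty sorted word whose last letter is outside \<open>H\<close> is already normal and
  contributes 0.
\<close>

function vac_word :: "sv_index list \<Rightarrow> complex" where
  "vac_word w = (if \<exists>u i j v. descent w u i j v
     then case SOME (u, i, j, v). descent w u i j v of (u, i, j, v) \<Rightarrow>
       vac_word (u @ j # i # v) + (\<Sum>k\<in>Poly_Mapping.keys (basis_bracket i j).
         Poly_Mapping.lookup (basis_bracket i j) k * vac_word (u @ k # v))
     else if w = [] then 1
     else if last w \<in> H then \<chi> (last w) * vac_word (butlast w)
     else 0)"
  by auto
termination
proof (relation "measures [length, inversions]")
  have *: "descent w u i j v" if "\<exists>u i j v. descent w u i j v"
    "(u, i, j, v) = (SOME (u, i, j, v). descent w u i j v)" for w u i j v
  proof -
    have "\<exists>t. case t of (u, i, j, v) \<Rightarrow> descent w u i j v"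
      using that(1) by auto
    from someI_ex[OF this] that(2)[symmetric] show ?thesis by simp
  qed
  have d: "descent w u i j v" if "\<exists>u i j v. descent w u i j v"
    "(u, y) = (SOME (u, i, j, v). descent w u i j v)" "(i, x) = y" "(j, v) = x" for w u i j v x y
    using that * by metis
  show "(u @ j # i # v, w) \<in> measures [length, inversions]"
    if "\<exists>u i j v. descent w u i j v"
      "(u, y) = (SOME (u, i, j, v). descent w u i j v)" "(i, x) = y" "(j, v) = x" for w u i j v x y
    using d[OF that] by (auto simp: descent_def inversions_swap)
  show "(u @ k # v, w) \<in> measures [length, inversions]"
    if "\<exists>u i j v. descent w u i j v"
      "(u, y) = (SOME (u, i, j, v). descent w u i j v)" "(i, x) = y" "(j, v) = x" for w u i j v x y k
    using d[OF that] by (auto simp: descent_def)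
qed simp_all

declare vac_word.simps [simp del]

definition vac :: "sv_index free_alg \<Rightarrow> complex" where
  "vac = linear_ext (\<lambda>w. vac_word (letters w))"

lemma vac_mono [simp]: "vac (monomial w) = vac_word w"
  by (simp add: vac_def monomial_def)

lemma vac_linear [simp]: "vac (p + q) = vac p + vac q" "vac (p - q) = vac p - vac q" "vac 0 = 0"
    "vac (pm_scale c p) = c * vac p"
  by (simp_all add: vac_def)

lemma vac_emb: "vac (monomial u * emb x * monomial v) = linear_ext (\<lambda>k. vac_word (u @ k # v)) x"
  by (induction x rule: single_add_induct)
    (simp_all add: distrib_left distrib_right mult.assoc flip: monomial_Cons monomial_append)

text \<open>
  Every rewriting step that applies to \<open>w\<close>, not only the one chosen in the recursion, preserves the
  value of \<open>vac_word\<close>.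
\<close>

definition consistent :: "sv_index list \<Rightarrow> bool" where
  "consistent w \<longleftrightarrow>
    (\<forall>u i j v. descent w u i j v \<longrightarrow>
       vac_word w = vac_word (u @ j # i # v) + vac (monomial u * emb (basis_bracket i j) * monomial v)) \<and>
    (\<forall>u h. w = u @ [h] \<longrightarrow> h \<in> H \<longrightarrow> vac_word w = \<chi> h * vac_word u)"

lemma vac_word_cases:
  obtains u i j v where "descent w u i j v"
    "vac_word w = vac_word (u @ j # i # v) + vac (monomial u * emb (basis_bracket i j) * monomial v)"
  | "\<nexists>u i j v. descent w u i j v"
    "vac_word w = (if w = [] then 1 else if last w \<in> H then \<chi> (last w) * vac_word (butlast w) else 0)"
proof (cases "\<exists>u i j v. descent w u i j v")
  case True
  obtain u i j v where t: "(SOME (u, i, j, v). descent w u i j v) = (u, i, j, v)"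
    by (metis prod_cases4)
  have "\<exists>t. case t of (u, i, j, v) \<Rightarrow> descent w u i j v"
    using True by auto
  from someI_ex[OF this] t have d: "descent w u i j v" by simp
  have "vac_word w = vac_word (u @ j # i # v) + vac (monomial u * emb (basis_bracket i j) * monomial v)"
    by (subst vac_word.simps) (use True t in \<open>simp add: vac_emb linear_ext_def additive_ext_def\<close>)
  with d that show ?thesis by blast
next
  case False
  then have "vac_word w = (if w = [] then 1 else if last w \<in> H then \<chi> (last w) * vac_word (butlast w) else 0)"
    by (subst vac_word.simps) (simp only: if_False)
  with False that(2) show ?thesis by blast
qed

lemma basis_bracket_antisym: "basis_bracket j i = - basis_bracket i j"
  using bracket_antisym[of "basis j" "basis i"] by simp

text \<open>
  One of the two orders of the letters is a descent, and the rewriting step at this descent is the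
  claim, up to a sign; equal letters have zero bracket.
\<close>

lemma consistent_commutator_basis:
  assumes "consistent (u @ i # j # v)" "consistent (u @ j # i # v)"
  shows "vac (monomial u * (gen i * gen j - gen j * gen i - emb (basis_bracket i j)) * monomial v) = 0"
proof -
  have *: "vac (monomial u * (gen i * gen j - gen j * gen i - emb x) * monomial v) =
    vac_word (u @ i # j # v) - vac_word (u @ j # i # v) - vac (monomial u * emb x * monomial v)" for i j x
    by (simp add: algebra_simps flip: monomial_Cons monomial_append)
  consider "key j < key i" | "key i < key j" | "i = j"
    using key_inj[of i j] by fastforce
  then show ?thesis
  proof cases
    case 1
    with assms(1) show ?thesis by (simp add: * consistent_def descent_def)
  next
    case 2
    then have "vac_word (u @ j # i # v) = vac_word (u @ i # j # v) + vac (monomial u * emb (basis_bracket j i) * monomial v)"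
      using assms(2) by (auto simp: consistent_def descent_def)
    moreover have "emb (basis_bracket j i) = - emb (basis_bracket i j)"
      using emb_diff[of 0 "basis_bracket i j"] by (simp add: basis_bracket_antisym[of j i])
    moreover have "vac (- p) = - vac p" for p
      using vac_linear(2)[of 0 p] by simp
    ultimately show ?thesis by (simp add: *)
  next
    case 3
    then have "basis_bracket i j = 0" by (cases i) auto
    with 3 show ?thesis by (simp add: *)
  qed
qed

lemma consistent_commutator:
  assumes "\<And>w. length w = length u + length v + 2 \<Longrightarrow> consistent w"
  shows "vac (monomial u * (emb x * emb y - emb y * emb x - emb (bracket x y)) * monomial v) = 0"
    (is "?C x y = 0")
proof -
  have add_l: "?C (x + x') y = ?C x y + ?C x' y"
    and add_r: "?C x (y + y') = ?C x y + ?C x y'" for x x' y y'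
    by (simp_all add: bracket_linear algebra_simps)
  have scale_l: "?C (pm_scale c x) y = c * ?C x y"
    and scale_r: "?C x (pm_scale c y) = c * ?C x y" for c x y
    by (simp_all add: bracket_linear flip: pm.scale_right_diff_distrib)
  \<comment> \<open>The expression is bilinear, so it suffices to check basis elements.\<close>
  show ?thesis
  proof (induction x rule: sv_induct)
    case (scale c i)
    have "?C (basis i) y = 0"
    proof (induction y rule: sv_induct)
      case (scale d j)
      have "?C (basis i) (basis j) = 0"
        using consistent_commutator_basis assms by simp
      then show ?case by (simp only: scale_r mult_zero_right)
    next
      case (add y y') then show ?case by (simp only: add_r add_0)
    qed simp
    then show ?case by (simp only: scale_l mult_zero_right)
  next
    case (add y y') then show ?case by (simp only: add_l add_0)
  qed simp
qed

text \<open>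
  The next two lemmas put the commutator relation next to a further linear combination of letters,
  as needed when two descents in different places of a word are removed.
\<close>

lemma consistent_commutator_left:
  assumes "\<And>w. length w = length a + length b + length c + 3 \<Longrightarrow> consistent w"
  shows "vac (monomial a * emb z * monomial b * (emb x * emb y - emb y * emb x - emb (bracket x y)) * monomial c) = 0"
proof (induction z rule: single_add_induct)
  case (single k t)
  have "vac (monomial (a @ k # b) * (emb x * emb y - emb y * emb x - emb (bracket x y)) * monomial c) = 0"
    by (intro consistent_commutator assms) simp
  then show ?case by (simp add: monomial_append monomial_Cons mult.assoc)
qed (simp add: distrib_left distrib_right)

lemma consistent_commutator_right:
  assumes "\<And>w. length w = length a + length b + length c + 3 \<Longrightarrow> consistent w"
  shows "vac (monomial a * (emb x * emb y - emb y * emb x - emb (bracket x y)) * monomial b * emb z * monomial c) = 0"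
proof (induction z rule: single_add_induct)
  case (single k t)
  have "vac (monomial a * (emb x * emb y - emb y * emb x - emb (bracket x y)) * monomial (b @ k # c)) = 0"
    by (intro consistent_commutator assms) simp
  then show ?case by (simp add: monomial_append monomial_Cons mult.assoc)
qed (simp add: distrib_left distrib_right)

definition smaller :: "sv_index list \<Rightarrow> sv_index list \<Rightarrow> bool" where
  "smaller v w \<longleftrightarrow> (v, w) \<in> measures [length, inversions]"

lemma smaller_length: "length v < length w \<Longrightarrow> smaller v w"
  by (simp add: smaller_def)

lemma smaller_swap: "key j < key i \<Longrightarrow> smaller (u @ j # i # v) (u @ i # j # v)"
  by (simp add: smaller_def inversions_swap)

lemma smaller_trans: "smaller u v \<Longrightarrow> smaller v w \<Longrightarrow> smaller u w"
  by (auto simp: smaller_def)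

lemma consistent_swap:
  assumes "consistent (u @ i # j # v)" "key j < key i"
  shows "vac (monomial (u @ i # j # v)) =
    vac (monomial (u @ j # i # v)) + vac (monomial u * emb (bracket (basis i) (basis j)) * monomial v)"
  using assms by (simp add: consistent_def descent_def)

text \<open>
  The two steps commute: after performing either of them the other one still applies, and both
  orders lead to the same four terms, the last of which contains both commutators.
\<close>

lemma disjoint_descents:
  assumes IH: "\<And>v. smaller v (a @ i # j # b @ k # l # c) \<Longrightarrow> consistent v"
    and "key j < key i" "key l < key k"
  shows "vac (monomial (a @ j # i # b @ k # l # c))
      + vac (monomial a * emb (bracket (basis i) (basis j)) * monomial (b @ k # l # c))
    = vac (monomial (a @ i # j # b @ l # k # c))
      + vac (monomial (a @ i # j # b) * emb (bracket (basis k) (basis l)) * monomial c)"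
proof -
  let ?x = "bracket (basis i) (basis j)" and ?y = "bracket (basis k) (basis l)"
  have 1: "vac (monomial (a @ j # i # b @ k # l # c)) =
      vac (monomial (a @ j # i # b @ l # k # c)) + vac (monomial (a @ j # i # b) * emb ?y * monomial c)"
    using consistent_swap[of "a @ j # i # b" k l c] IH smaller_swap[of j i a] assms by simp
  have 2: "vac (monomial (a @ i # j # b @ l # k # c)) =
      vac (monomial (a @ j # i # b @ l # k # c)) + vac (monomial a * emb ?x * monomial (b @ l # k # c))"
    using consistent_swap[of a i j "b @ l # k # c"] IH smaller_swap[of l k "a @ i # j # b"] assms by simp
  have "vac (monomial a * emb ?x * monomial b * (emb (basis k) * emb (basis l)
      - emb (basis l) * emb (basis k) - emb ?y) * monomial c) = 0"
    by (rule consistent_commutator_left) (auto intro!: IH smaller_length)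
  then have 3: "vac (monomial a * emb ?x * monomial (b @ k # l # c)) =
      vac (monomial a * emb ?x * monomial (b @ l # k # c)) + vac (monomial a * emb ?x * monomial b * emb ?y * monomial c)"
    by (simp add: monomial_append monomial_Cons algebra_simps)
  have "vac (monomial a * (emb (basis i) * emb (basis j)
      - emb (basis j) * emb (basis i) - emb ?x) * monomial b * emb ?y * monomial c) = 0"
    by (rule consistent_commutator_right) (auto intro!: IH smaller_length)
  then have 4: "vac (monomial (a @ i # j # b) * emb ?y * monomial c) =
      vac (monomial (a @ j # i # b) * emb ?y * monomial c) + vac (monomial a * emb ?x * monomial b * emb ?y * monomial c)"
    by (simp add: monomial_append monomial_Cons algebra_simps)
  show ?thesis
    using 1 2 3 4 by simp
qed

text \<open>
  The critical case of the diamond lemma. Either step can be continued until the three letters are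
  sorted; the commutator terms collected on the two ways differ by the three double brackets of the
  Jacobi identity.
\<close>

lemma overlapping_descents:
  assumes IH: "\<And>v. smaller v (a @ i # j # k # c) \<Longrightarrow> consistent v"
    and ij: "key j < key i" and jk: "key k < key j"
  shows "vac (monomial (a @ j # i # k # c))
      + vac (monomial a * emb (bracket (basis i) (basis j)) * monomial (k # c))
    = vac (monomial (a @ i # k # j # c))
      + vac (monomial (a @ [i]) * emb (bracket (basis j) (basis k)) * monomial c)"
proof -
  let ?ij = "bracket (basis i) (basis j)" and ?jk = "bracket (basis j) (basis k)"
    and ?ik = "bracket (basis i) (basis k)"
  have ik: "key k < key i" using ij jk by simp
  have s1: "smaller (a @ j # i # k # c) (a @ i # j # k # c)"
    by (rule smaller_swap[OF ij])
  have s2: "smaller (a @ i # k # j # c) (a @ i # j # k # c)"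
    using smaller_swap[OF jk, of "a @ [i]"] by simp
  have s3: "smaller (a @ j # k # i # c) (a @ i # j # k # c)"
    using smaller_trans[OF _ s1] smaller_swap[OF ik, of "a @ [j]"] by simp
  have s4: "smaller (a @ k # i # j # c) (a @ i # j # k # c)"
    using smaller_trans[OF _ s2] smaller_swap[OF ik, of a] by simp
  have g1: "vac (monomial (a @ j # i # k # c)) =
      vac (monomial (a @ j # k # i # c)) + vac (monomial (a @ [j]) * emb ?ik * monomial c)"
    using consistent_swap[of "a @ [j]" i k c] IH[OF s1] ik by simp
  have g2: "vac (monomial (a @ j # k # i # c)) =
      vac (monomial (a @ k # j # i # c)) + vac (monomial a * emb ?jk * monomial (i # c))"
    using consistent_swap[of a j k "i # c"] IH[OF s3] jk by simp
  have g3: "vac (monomial (a @ i # k # j # c)) =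
      vac (monomial (a @ k # i # j # c)) + vac (monomial a * emb ?ik * monomial (j # c))"
    using consistent_swap[of a i k "j # c"] IH[OF s2] ik by simp
  have g4: "vac (monomial (a @ k # i # j # c)) =
      vac (monomial (a @ k # j # i # c)) + vac (monomial (a @ [k]) * emb ?ij * monomial c)"
    using consistent_swap[of "a @ [k]" i j c] IH[OF s4] ij by simp
  have C: "vac (monomial a * (emb x * emb y) * monomial c) = vac (monomial a * (emb y * emb x) * monomial c)
      + vac (monomial a * emb (bracket x y) * monomial c)" for x y
  proof -
    have "vac (monomial a * (emb x * emb y - emb y * emb x - emb (bracket x y)) * monomial c) = 0"
      by (rule consistent_commutator) (auto intro!: IH smaller_length)
    then show ?thesis by (simp add: algebra_simps)
  qed
  have "bracket ?ij (basis k) + bracket (basis j) ?ik + bracket ?jk (basis i) = 0"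
    using bracket_jacobi[of "basis i" "basis j" "basis k"] bracket_antisym[of "basis k" ?ij]
      bracket_antisym[of "basis k" "basis i"] bracket_antisym[of "basis i" ?jk]
    by (simp add: bracket_uminus_right algebra_simps del: bracket_basis) (metis add.commute add.assoc add_eq_0_iff)
  then have "vac (monomial a * emb (bracket ?ij (basis k) + bracket (basis j) ?ik + bracket ?jk (basis i)) * monomial c) = 0"
    by simp
  then have J: "vac (monomial a * emb (bracket ?ij (basis k)) * monomial c)
      + vac (monomial a * emb (bracket (basis j) ?ik) * monomial c)
      + vac (monomial a * emb (bracket ?jk (basis i)) * monomial c) = 0"
    by (simp only: emb_add distrib_left distrib_right vac_linear)
  note C[of ?ij "basis k"] C[of "basis j" ?ik] C[of ?jk "basis i"]
  then show ?thesis
    using g1 g2 g3 g4 J by (simp add: monomial_append monomial_Cons mult.assoc add_ac del: bracket_basis)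
qed

lemma vac_character:
  assumes consistent: "\<And>k. consistent (u @ k # v @ [h])" and "h \<in> H"
  shows "vac (monomial u * emb x * monomial (v @ [h])) = \<chi> h * vac (monomial u * emb x * monomial v)"
proof -
  have "vac_word (u @ k # v @ [h]) = \<chi> h * vac_word (u @ k # v)" for k
    using consistent[of k] \<open>h \<in> H\<close> unfolding consistent_def by (metis append_Cons append_assoc)
  then show ?thesis
    unfolding vac_emb linear_ext_def additive_ext_def by (simp add: sum_distrib_left mult_ac)
qed

text \<open>
  The step at a descent against the step that removes a last letter \<open>h\<close> from \<open>H\<close>. If the descent
  involves \<open>h\<close>, then both of its letters are in \<open>H\<close>, because \<open>H\<close> lies on top of the order, and the
  commutator contributes nothing since \<open>\<chi>\<close> vanishes on brackets.
\<close>

lemma descent_character: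
  assumes IH: "\<And>v. smaller v (u @ [h]) \<Longrightarrow> consistent v"
    and "descent (u @ [h]) a i j c" "h \<in> H"
  shows "vac (monomial (a @ j # i # c))
      + vac (monomial a * emb (bracket (basis i) (basis j)) * monomial c) = \<chi> h * vac_word u"
proof (cases c rule: rev_cases)
  case Nil
  with assms have [simp]: "u = a @ [i]" "j = h" and ih: "key h < key i"
    by (auto simp: descent_def)
  have "i \<in> H" using key_H ih \<open>h \<in> H\<close> by blast
  have last: "vac_word (a @ [k]) = \<chi> k * vac_word a" if "k \<in> H" for k
    using IH[of "a @ [k]"] that by (auto simp: consistent_def smaller_length)
  have "vac_word (a @ [h, i]) = \<chi> i * vac_word (a @ [h])"
  proof -
    have "consistent ((a @ [h]) @ [i])"
      using IH smaller_swap[OF ih, of a "[]"] by simp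
    then show ?thesis
      using \<open>i \<in> H\<close> unfolding consistent_def by auto
  qed
  also have "\<dots> = \<chi> h * vac_word u"
    using last \<open>h \<in> H\<close> \<open>i \<in> H\<close> by simp
  finally have 1: "vac_word (a @ [h, i]) = \<chi> h * vac_word u" .
  have "vac (monomial a * emb (basis_bracket i h) * monomial []) =
      linear_ext (\<lambda>k. vac_word (a @ [k])) (basis_bracket i h)"
    by (rule vac_emb)
  also have "\<dots> = linear_ext \<chi> (basis_bracket i h) * vac_word a"
    using keys_bracket[OF \<open>i \<in> H\<close> \<open>h \<in> H\<close>] unfolding linear_ext_def additive_ext_def sum_distrib_right
    by (intro sum.cong) (auto simp: last)
  finally show ?thesis
    using 1 Nil char_bracket[OF \<open>i \<in> H\<close> \<open>h \<in> H\<close>] by simp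
next
  case (snoc b k)
  with assms have [simp]: "k = h" "u = a @ i # j # b" and ij: "key j < key i"
    by (auto simp: descent_def)
  have "vac_word (a @ j # i # b @ [h]) = \<chi> h * vac_word (a @ j # i # b)"
  proof -
    have "consistent ((a @ j # i # b) @ [h])"
      using IH smaller_swap[OF ij, of a "b @ [h]"] by simp
    then show ?thesis
      using \<open>h \<in> H\<close> unfolding consistent_def by auto
  qed
  moreover have "vac (monomial a * emb (bracket (basis i) (basis j)) * monomial (b @ [h])) =
      \<chi> h * vac (monomial a * emb (bracket (basis i) (basis j)) * monomial b)"
    by (rule vac_character) (auto intro!: IH smaller_length \<open>h \<in> H\<close>)
  moreover have "vac_word u = vac_word (a @ j # i # b) + vac (monomial a * emb (bracket (basis i) (basis j)) * monomial b)"
    using consistent_swap[of a i j b] ij IH[of u] by (simp add: smaller_length)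
  ultimately show ?thesis
    using snoc by (simp add: distrib_left)
qed

lemma two_descents:
  assumes IH: "\<And>v. smaller v w \<Longrightarrow> consistent v"
    and "descent w a i j c" "descent w a' i' j' c'"
  shows "vac (monomial (a @ j # i # c)) + vac (monomial a * emb (bracket (basis i) (basis j)) * monomial c)
    = vac (monomial (a' @ j' # i' # c')) + vac (monomial a' * emb (bracket (basis i') (basis j')) * monomial c')"
  using assms(2,3)
proof (induction "length a" "length a'" arbitrary: a i j c a' i' j' c' rule: linorder_wlog)
  case le
  note d = le(2,3)
  then obtain b where b: "a' = a @ b" "i # j # c = b @ i' # j' # c'"
    using le(1) by (auto simp: descent_def append_eq_append_conv_if) (metis append_take_drop_id)
  consider "b = []" | "b = [i]" | b' where "b = i # j # b'"
    using b(2) by (cases b; cases "tl b") auto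
  then show ?case
  proof cases
    case 1
    with b show ?thesis by simp
  next
    case 2
    with b d show ?thesis
      using overlapping_descents[of a i j j' c'] IH by (auto simp: descent_def)
  next
    case 3
    with b d show ?thesis
      using disjoint_descents[of a i j b' i' j' c'] IH by (auto simp: descent_def)
  qed
next
  case sym
  then show ?case by metis
qed

theorem all_consistent: "consistent w"
proof (induction w rule: wf_induct_rule[OF wf_measures[of "[length, inversions]"]])
  case (1 w)
  then have IH: "consistent v" if "smaller v w" for v
    using that by (simp add: smaller_def)
  show ?case
  proof (cases w rule: vac_word_cases)
    case (1 u i j v)
    then have vac_word: "vac_word w = vac (monomial (u @ j # i # v))
        + vac (monomial u * emb (bracket (basis i) (basis j)) * monomial v)"
      by simp
    show ?thesis
      unfolding consistent_def
    proof (intro conjI allI impI)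
      fix u' i' j' v' assume d: "descent w u' i' j' v'"
      then show "vac_word w = vac_word (u' @ j' # i' # v') + vac (monomial u' * emb (basis_bracket i' j') * monomial v')"
        using two_descents[OF IH d 1(1)] vac_word by simp
    next
      fix u' h assume "w = u' @ [h]" "h \<in> H"
      then show "vac_word w = \<chi> h * vac_word u'"
        using descent_character[of u' h u i j v] IH 1(1) vac_word by simp
    qed
  next
    case 2
    then show ?thesis
      by (auto simp: consistent_def)
  qed
qed

lemma vac_commutator:
  "vac (p * (emb x * emb y - emb y * emb x - emb (bracket x y)) * q) = 0"
proof (induction p rule: single_add_induct)
  case (single k c)
  have k: "Poly_Mapping.single k c = pm_scale c (monomial (letters k))" for k :: "sv_index word" and c
    by (simp add: monomial_def)
  show ?case
  proof (induction q rule: single_add_induct)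
    case (single l d)
    show ?case
      unfolding k by (simp add: consistent_commutator all_consistent del: bracket_basis)
  qed (simp add: distrib_left)
qed (simp add: distrib_right)

lemma vac_right_character:
  assumes "h \<in> H"
  shows "vac (p * gen h) = \<chi> h * vac p"
proof (induction p rule: single_add_induct)
  case (single k c)
  have k: "Poly_Mapping.single k c = pm_scale c (monomial (letters k))"
    by (simp add: monomial_def)
  have "monomial (letters k) * gen h = monomial (letters k @ [h])"
    by (simp add: monomial_append monomial_Cons)
  moreover have "vac_word (letters k @ [h]) = \<chi> h * vac_word (letters k)"
    using all_consistent[of "letters k @ [h]"] assms by (simp add: consistent_def)
  ultimately show ?case
    unfolding k by simp
qed (simp add: distrib_left distrib_right)

lemma vac_one: "vac 1 = 1"
proof -
  have "vac_word [] = 1"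
    by (cases "[]::sv_index list" rule: vac_word_cases) (auto simp: descent_def)
  then show ?thesis
    using vac_mono[of "[]"] by simp
qed

end

section \<open>Algebra homomorphisms out of a free algebra\<close>

text \<open>
  \<open>s\<close> is the structure map of an algebra over the complex numbers. It is instantiated with the
  identity, for characters, and with the scalars of a free algebra.
\<close>

locale central_scalars =
  fixes s :: "complex \<Rightarrow> 'r::ring_1"
  assumes s_add: "s (a + b) = s a + s b" and s_mult: "s (a * b) = s a * s b"
    and s_one: "s 1 = 1" and s_central: "s a * r = r * s a"
begin

definition word_hom :: "('g \<Rightarrow> 'r) \<Rightarrow> 'g free_alg \<Rightarrow> 'r" where
  "word_hom \<phi> = additive_ext (\<lambda>w c. s c * prod_list (map \<phi> (letters w)))"

lemma s_zero: "s 0 = 0"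
  by (rule additive_zero) (rule s_add)

lemma word_hom_single: "word_hom \<phi> (Poly_Mapping.single w c) = s c * prod_list (map \<phi> (letters w))"
  by (simp add: word_hom_def additive_ext_single s_zero)

lemma word_hom_add: "word_hom \<phi> (p + q) = word_hom \<phi> p + word_hom \<phi> q"
  by (simp add: word_hom_def additive_ext_add s_add distrib_right)

lemma word_hom_diff: "word_hom \<phi> (p - q) = word_hom \<phi> p - word_hom \<phi> q"
  by (rule additive_diff) (rule word_hom_add)

lemma word_hom_one: "word_hom \<phi> (1 :: 'g free_alg) = 1"
proof -
  have *: "(1 :: 'g free_alg) = Poly_Mapping.single (Word []) 1"
    by (simp flip: zero_word_def)
  show ?thesis
    by (subst *) (simp add: word_hom_single s_one)
qed

lemma word_hom_zero: "word_hom \<phi> 0 = 0"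
  by (rule additive_zero) (rule word_hom_add)

lemma word_hom_gen: "word_hom \<phi> (gen x) = \<phi> x"
  by (simp add: gen_def word_hom_single s_one)

lemma word_hom_scale: "word_hom \<phi> (pm_scale c p) = s c * word_hom \<phi> p"
  by (induction p rule: single_add_induct)
    (simp_all add: word_hom_single word_hom_add s_mult mult.assoc distrib_left pm.scale_right_distrib)

lemma word_hom_mult: "word_hom \<phi> (p * q) = word_hom \<phi> p * word_hom \<phi> q"
proof (induction p rule: single_add_induct)
  case (single v a)
  show ?case
  proof (induction q rule: single_add_induct)
    case (single w b)
    have "s a * s b * (P * Q) = s a * P * (s b * Q)" for P Q
      by (metis mult.assoc s_central)
    then show ?case
      by (simp add: mult_single word_hom_single plus_word_def s_mult)
  qed (simp add: distrib_left word_hom_add)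
qed (simp add: distrib_right word_hom_add)

end

interpretation complex_scalars: central_scalars "\<lambda>c. c :: complex"
  by unfold_locales simp_all

interpretation free_alg_scalars: central_scalars "scalar :: complex \<Rightarrow> 'g free_alg"
  by unfold_locales (simp_all add: single_add mult_single scalar_mult mult_scalar mult.commute)

lemma psi_ext_eq: "psi_ext \<psi> = complex_scalars.word_hom \<psi>"
  by (simp add: psi_ext_def complex_scalars.word_hom_def additive_ext_def fun_eq_iff)

section \<open>Classes in enveloping algebras\<close>

definition closed_under_ops :: "sv set \<Rightarrow> bool" where
  "closed_under_ops S \<longleftrightarrow> (\<forall>x\<in>S. \<forall>y\<in>S. x + y \<in> S \<and> bracket x y \<in> S) \<and>
     (\<forall>c. \<forall>x\<in>S. pm_scale c x \<in> S)"

lemma closed_under_ops_UNIV [simp]: "closed_under_ops UNIV"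
  by (simp add: closed_under_ops_def)

lemma closed_under_ops_sv_plus [simp]: "closed_under_ops sv_plus"
  using sv_plus_bracket_closed
  by (auto simp: closed_under_ops_def sv_plus_def intro: pm.span_add pm.span_scale)

lemma carrier_free_alg: "p \<in> carrier (free_alg S) \<longleftrightarrow> (\<forall>w\<in>Poly_Mapping.keys p. set (letters w) \<subseteq> S)"
  by (simp add: free_alg_def)

lemma carrier_free_alg_UNIV [simp]: "carrier (free_alg UNIV) = UNIV"
  by (simp add: free_alg_def)

lemma free_alg_ops [simp]:
  "mult (free_alg S) = (*)" "one (free_alg S) = 1"
  "ring.zero (free_alg S) = 0" "ring.add (free_alg S) = (+)"
  by (simp_all add: free_alg_def)

lemma free_alg_closed:
  "p \<in> carrier (free_alg S) \<Longrightarrow> q \<in> carrier (free_alg S) \<Longrightarrow> p + q \<in> carrier (free_alg S)"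
  "p \<in> carrier (free_alg S) \<Longrightarrow> q \<in> carrier (free_alg S) \<Longrightarrow> p * q \<in> carrier (free_alg S)"
  "p \<in> carrier (free_alg S) \<Longrightarrow> - p \<in> carrier (free_alg S)"
  "p \<in> carrier (free_alg S) \<Longrightarrow> q \<in> carrier (free_alg S) \<Longrightarrow> p - q \<in> carrier (free_alg S)"
  "0 \<in> carrier (free_alg S)" "1 \<in> carrier (free_alg S)"
  "x \<in> S \<Longrightarrow> gen x \<in> carrier (free_alg S)"
  "p \<in> carrier (free_alg S) \<Longrightarrow> pm_scale c p \<in> carrier (free_alg S)"
proof -
  interpret R: ring "free_alg S" by (rule ring_free_alg)
  show add: "p + q \<in> carrier (free_alg S)" if "p \<in> carrier (free_alg S)" "q \<in> carrier (free_alg S)" for p q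
    using R.a_closed[OF that] by simp
  show "p * q \<in> carrier (free_alg S)" if "p \<in> carrier (free_alg S)" "q \<in> carrier (free_alg S)" for p q
    using R.m_closed[OF that] by simp
  show uminus: "- p \<in> carrier (free_alg S)" if "p \<in> carrier (free_alg S)" for p
    using that by (simp add: carrier_free_alg)
  show "p - q \<in> carrier (free_alg S)" if "p \<in> carrier (free_alg S)" "q \<in> carrier (free_alg S)" for p q
    using add[OF that(1) uminus[OF that(2)]] by simp
  show "0 \<in> carrier (free_alg S)" "1 \<in> carrier (free_alg S)"
    using R.zero_closed R.one_closed by simp_all
  show "gen x \<in> carrier (free_alg S)" if "x \<in> S"
    using that by (simp add: carrier_free_alg gen_def)
  show "pm_scale c p \<in> carrier (free_alg S)" if "p \<in> carrier (free_alg S)"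
    using that by (auto simp: carrier_free_alg in_keys_iff)
qed

lemma env_rels_carrier:
  assumes "closed_under_ops S"
  shows "env_rels S \<subseteq> carrier (free_alg S)"
  using assms unfolding env_rels_def closed_under_ops_def
  by (auto intro!: free_alg_closed)

lemma ideal_env_ideal:
  assumes "closed_under_ops S"
  shows "ideal (env_ideal S) (free_alg S)"
  unfolding env_ideal_def
  using ring.genideal_ideal[OF ring_free_alg env_rels_carrier[OF assms]] .

text \<open>
  An induction principle for the two-sided ideal of relations; additive inverses are covered by
  multiplication with \<open>- 1\<close>.
\<close>

lemma env_ideal_least:
  assumes S: "closed_under_ops S"
    and rels: "\<And>r. r \<in> env_rels S \<Longrightarrow> P r"
    and zero: "P 0" and add: "\<And>p q. P p \<Longrightarrow> P q \<Longrightarrow> P (p + q)"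
    and left: "\<And>p q. P p \<Longrightarrow> q \<in> carrier (free_alg S) \<Longrightarrow> P (q * p)"
    and right: "\<And>p q. P p \<Longrightarrow> q \<in> carrier (free_alg S) \<Longrightarrow> P (p * q)"
    and p: "p \<in> env_ideal S"
  shows "P p"
proof -
  interpret R: ring "free_alg S" by (rule ring_free_alg)
  let ?I = "{p \<in> carrier (free_alg S). P p}"
  have neg: "inv\<^bsub>add_monoid (free_alg S)\<^esub> p = - p" if "p \<in> carrier (free_alg S)" for p
    unfolding a_inv_def[symmetric]
    using that by (intro R.minus_equality) (auto intro: free_alg_closed)
  have "P (- p)" if "P p" for p
    using left[OF that, of "- 1"] by (simp add: free_alg_closed)
  then have "subgroup ?I (add_monoid (free_alg S))"
    by unfold_locales (auto simp: neg[simplified] zero add free_alg_closed)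
  then have "ideal ?I (free_alg S)"
    by (intro idealI ring_free_alg) (auto simp: left right free_alg_closed)
  moreover have "env_rels S \<subseteq> ?I"
    using rels env_rels_carrier[OF S] by auto
  ultimately have "env_ideal S \<subseteq> ?I"
    unfolding env_ideal_def by (rule R.genideal_minimal)
  with p show ?thesis by auto
qed

context
  fixes S :: "sv set"
  assumes S: "closed_under_ops S"
begin

interpretation ideal "env_ideal S" "free_alg S"
  by (rule ideal_env_ideal[OF S])

lemma env_ideal_rels: "r \<in> env_rels S \<Longrightarrow> r \<in> env_ideal S"
  using ring.genideal_self[OF ring_free_alg env_rels_carrier[OF S]] by (auto simp: env_ideal_def)

lemma env_ideal_zero: "0 \<in> env_ideal S"
  using additive_subgroup.zero_closed[OF additive_subgroup_axioms] by simp

lemma env_ideal_add: "p \<in> env_ideal S \<Longrightarrow> q \<in> env_ideal S \<Longrightarrow> p + q \<in> env_ideal S"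
  using additive_subgroup.a_closed[OF additive_subgroup_axioms] by simp

lemma env_ideal_mult:
  "p \<in> env_ideal S \<Longrightarrow> q \<in> carrier (free_alg S) \<Longrightarrow> q * p \<in> env_ideal S"
  "p \<in> env_ideal S \<Longrightarrow> q \<in> carrier (free_alg S) \<Longrightarrow> p * q \<in> env_ideal S"
  using I_l_closed I_r_closed by simp_all

lemma env_ideal_uminus: "p \<in> env_ideal S \<Longrightarrow> - p \<in> env_ideal S"
  using env_ideal_mult(1)[of p "- 1"] by (simp add: free_alg_closed)

lemma env_ideal_diff: "p \<in> env_ideal S \<Longrightarrow> q \<in> env_ideal S \<Longrightarrow> p - q \<in> env_ideal S"
  using env_ideal_add[OF _ env_ideal_uminus] by force

lemma mem_env_class: "q \<in> env_class S p \<longleftrightarrow> q - p \<in> env_ideal S"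
  by (force simp: env_class_def a_r_coset_def r_coset_def)

lemma env_class_eq: "p \<in> carrier (free_alg S) \<Longrightarrow> q \<in> carrier (free_alg S) \<Longrightarrow>
    env_class S p = env_class S q \<longleftrightarrow> p - q \<in> env_ideal S"
proof
  assume "env_class S p = env_class S q"
  then show "p - q \<in> env_ideal S"
    using mem_env_class[of p p] mem_env_class[of p q] env_ideal_zero by simp
next
  assume *: "p - q \<in> env_ideal S"
  have "r - q \<in> env_ideal S \<longleftrightarrow> r - p \<in> env_ideal S" for r
    using env_ideal_add[OF _ *, of "r - p"] env_ideal_diff[OF _ *, of "r - q"] by auto
  then show "env_class S p = env_class S q"
    by (auto simp: mem_env_class)
qed

lemma carrier_env: "carrier (env S) = env_class S ` carrier (free_alg S)"
  by (auto simp: env_def env_class_def FactRing_def A_RCOSETS_def')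

lemma env_class_add:
  assumes "p \<in> carrier (free_alg S)" "q \<in> carrier (free_alg S)"
  shows "env_class S p \<oplus>\<^bsub>env S\<^esub> env_class S q = env_class S (p + q)"
  using a_rcos_sum[OF assms] by (simp add: env_def env_class_def FactRing_def)

lemma env_class_mult:
  assumes "p \<in> carrier (free_alg S)" "q \<in> carrier (free_alg S)"
  shows "env_class S p \<otimes>\<^bsub>env S\<^esub> env_class S q = env_class S (p * q)"
  using rcoset_mult_add[OF assms] by (simp add: env_def env_class_def FactRing_def)

lemma ring_env: "ring (env S)"
  unfolding env_def by (rule quotient_is_ring)

lemma env_class_diff:
  assumes "p \<in> carrier (free_alg S)" "q \<in> carrier (free_alg S)"
  shows "env_class S p \<ominus>\<^bsub>env S\<^esub> env_class S q = env_class S (p - q)"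
proof -
  interpret E: ring "env S" by (rule ring_env)
  have "env_class S (p - q) \<oplus>\<^bsub>env S\<^esub> env_class S q = env_class S p"
    using assms by (simp add: env_class_add free_alg_closed)
  then show ?thesis
    using assms carrier_env by (metis E.add.inv_solve_right' E.minus_eq free_alg_closed(4) image_eqI)
qed

end

lemma M0_minus_eq: "M0_minus \<xi> = env_class UNIV (gen (basis (Mgen 0)) - pm_scale \<xi> 1)"
  by (simp add: M0_minus_def env_gen_def env_scalar_def env_class_diff)

lemma env_ideal_mono:
  assumes "closed_under_ops S"
  shows "env_ideal S \<subseteq> env_ideal UNIV"
proof
  fix p assume "p \<in> env_ideal S"
  then show "p \<in> env_ideal UNIV"
  proof (rule env_ideal_least[OF assms, rotated -1])
    show "r \<in> env_ideal UNIV" if "r \<in> env_rels S" for r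
      using that by (intro env_ideal_rels) (auto simp: env_rels_def)
  qed (simp_all add: env_ideal_zero env_ideal_add env_ideal_mult)
qed

lemma env_incl_class:
  assumes "closed_under_ops S" "p \<in> carrier (free_alg S)"
  shows "env_incl (env_class S p) = env_class UNIV p"
proof -
  have "env_class UNIV q = env_class UNIV p" if "q \<in> env_class S p" for q
    using that env_ideal_mono[OF assms(1)] by (auto simp: env_class_eq mem_env_class[OF assms(1)])
  moreover have "p \<in> env_class S p"
    by (simp add: mem_env_class[OF assms(1)] env_ideal_zero[OF assms(1)])
  ultimately show ?thesis
    unfolding env_incl_def by blast
qed

lemma psi_ext_env_ideal:
  assumes "lie_hom_plus \<psi>" "p \<in> env_ideal sv_plus"
  shows "psi_ext \<psi> p = 0"
  using assms(2)
proof (rule env_ideal_least[rotated -1])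
  show "psi_ext \<psi> r = 0" if "r \<in> env_rels sv_plus" for r
    using that assms(1) unfolding env_rels_def lie_hom_plus_def psi_ext_eq
    by (auto simp: complex_scalars.word_hom_diff complex_scalars.word_hom_gen
        complex_scalars.word_hom_mult complex_scalars.word_hom_scale)
qed (simp_all add: psi_ext_eq complex_scalars.word_hom_add complex_scalars.word_hom_mult
    complex_scalars.word_hom_zero)

lemma C_mod_smult:
  assumes "lie_hom_plus \<psi>" "p \<in> carrier (free_alg sv_plus)"
  shows "env_class sv_plus p \<odot>\<^bsub>C_mod \<psi>\<^esub> \<alpha> = psi_ext \<psi> p * \<alpha>"
proof -
  have "psi_ext \<psi> q = psi_ext \<psi> p" if "q \<in> env_class sv_plus p" for q
  proof -
    have "psi_ext \<psi> (q - p) = 0"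
      using that by (intro psi_ext_env_ideal assms) (simp add: mem_env_class)
    then show ?thesis by (simp add: psi_ext_eq complex_scalars.word_hom_diff)
  qed
  moreover have "p \<in> env_class sv_plus p"
    by (simp add: mem_env_class env_ideal_zero)
  ultimately have "psi_ext \<psi> ` env_class sv_plus p = {psi_ext \<psi> p}"
    by blast
  then show ?thesis by (simp add: C_mod_def)
qed

section \<open>The grading and a Whittaker functional on the enveloping algebra\<close>

text \<open>
  Twice the usual degree, so that it is an integer at the half-integral \<open>Y\<close>.
\<close>

fun deg :: "sv_index \<Rightarrow> int" where
  "deg (Lgen n) = 2 * n"
| "deg (Mgen n) = 2 * n"
| "deg (Ygen n) = 2 * n + 1"

lemma sv_plus_eq: "sv_plus = pm.span (basis ` {i. deg i > 0})"
proof -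
  have "i \<in> {Lgen n | n. n \<ge> 1} \<union> {Mgen n | n. n \<ge> 1} \<union> {Ygen m | m. m \<ge> 0} \<longleftrightarrow> deg i > 0" for i
    by (cases i) auto
  then have "{Lgen n | n. n \<ge> 1} \<union> {Mgen n | n. n \<ge> 1} \<union> {Ygen m | m. m \<ge> 0} = {i. deg i > 0}"
    by blast
  then show ?thesis by (simp add: sv_plus_def)
qed

lemma basis_sv_plus: "deg i > 0 \<Longrightarrow> basis i \<in> sv_plus"
  by (auto simp: sv_plus_eq intro: pm.span_base)

lemma sv_plus_induct [consumes 1, case_names zero step]:
  assumes "x \<in> sv_plus" "P 0"
    "\<And>c i y. deg i > 0 \<Longrightarrow> y \<in> sv_plus \<Longrightarrow> P y \<Longrightarrow> P (pm_scale c (basis i) + y)"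
  shows "P x"
proof -
  have "x \<in> sv_plus \<and> P x"
    using assms(1) unfolding sv_plus_eq
  proof (induction rule: pm.span_induct_alt)
    case base
    show ?case using assms(2) pm.span_zero by auto
  next
    case (step c u y)
    then show ?case using assms(3)[of _ y c]
      by (auto simp: sv_plus_eq intro: pm.span_add pm.span_scale pm.span_base)
  qed
  then show ?thesis ..
qed

lemma lie_hom_plus_zero: "lie_hom_plus \<psi> \<Longrightarrow> \<psi> 0 = 0"
  unfolding lie_hom_plus_def using pm.span_zero[of "basis ` {i. deg i > 0}"]
  by (metis mult_zero_left pm.scale_zero_left sv_plus_eq)

lemma lie_hom_plus_step:
  assumes "lie_hom_plus \<psi>" "deg i > 0" "y \<in> sv_plus"
  shows "\<psi> (pm_scale c (basis i) + y) = c * \<psi> (basis i) + \<psi> y"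
  using assms basis_sv_plus[OF assms(2)] unfolding lie_hom_plus_def
  by (simp add: sv_plus_eq pm.span_scale)

lemma keys_sv_plus: "x \<in> sv_plus \<Longrightarrow> Poly_Mapping.keys x \<subseteq> {i. deg i > 0}"
proof (induction rule: sv_plus_induct)
  case (step c i y)
  have "Poly_Mapping.keys (pm_scale c (basis i)) \<subseteq> {i}"
    by (auto simp: basis_def split: if_splits)
  then show ?case
    using step Poly_Mapping.keys_add[of "pm_scale c (basis i)" y] by auto
qed simp

text \<open>
  The subalgebra spanned by \<open>sv_plus\<close> and \<open>M\<^sub>0\<close> has a character that extends \<open>\<psi>\<close> by \<open>\<xi>\<close> at \<open>M\<^sub>0\<close>,
  because \<open>M\<^sub>0\<close> is central and no bracket of elements of \<open>sv_plus\<close> involves it. The functional is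
  \<open>vac\<close> for this character, pulled back along the map that expands each generator in the basis.
\<close>

theorem whittaker_functional:
  assumes "lie_hom_plus \<psi>"
  obtains \<Phi> :: "sv free_alg \<Rightarrow> complex" where
    "\<And>p q. \<Phi> (p + q) = \<Phi> p + \<Phi> q" "\<And>c p. \<Phi> (pm_scale c p) = c * \<Phi> p" "\<Phi> 1 = 1"
    "\<And>p. p \<in> env_ideal UNIV \<Longrightarrow> \<Phi> p = 0"
    "\<And>p x. x \<in> sv_plus \<Longrightarrow> \<Phi> (p * gen x) = \<psi> x * \<Phi> p"
    "\<And>p. \<Phi> (p * gen (basis (Mgen 0))) = \<xi> * \<Phi> p"
proof -
  define H where "H = insert (Mgen 0) {i. deg i > 0}"
  define \<chi> where "\<chi> i = (if i = Mgen 0 then \<xi> else \<psi> (basis i))" for i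
  have \<chi>: "linear_ext \<chi> x = \<psi> x" if "x \<in> sv_plus" for x
    using that
  proof (induction rule: sv_plus_induct)
    case zero
    then show ?case by (simp add: lie_hom_plus_zero[OF assms])
  next
    case (step c i y)
    then have "i \<noteq> Mgen 0" by auto
    with step show ?case
      by (simp add: lie_hom_plus_step[OF assms]) (simp add: basis_def \<chi>_def)
  qed
  have M0: "basis_bracket i (Mgen 0) = 0" "basis_bracket (Mgen 0) i = 0" for i
    by (cases i; simp)+
  interpret induced_character H \<chi>
  proof
    fix i j assume "i \<in> H" "j \<in> H"
    then consider "i = Mgen 0 \<or> j = Mgen 0" | "deg i > 0" "deg j > 0"
      by (auto simp: H_def)
    then have "Poly_Mapping.keys (basis_bracket i j) \<subseteq> H \<and> linear_ext \<chi> (basis_bracket i j) = 0"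
    proof cases
      case 2
      then have *: "basis i \<in> sv_plus" "basis j \<in> sv_plus"
        by (auto intro: basis_sv_plus)
      then have **: "basis_bracket i j \<in> sv_plus"
        using sv_plus_bracket_closed[OF *] by simp
      have "Poly_Mapping.keys (basis_bracket i j) \<subseteq> H"
        using keys_sv_plus[OF **] by (auto simp: H_def)
      moreover have "linear_ext \<chi> (basis_bracket i j) = 0"
        using \<chi>[OF **] * assms unfolding lie_hom_plus_def by (metis bracket_basis)
      ultimately show ?thesis ..
    qed (auto simp: M0)
    then show "Poly_Mapping.keys (basis_bracket i j) \<subseteq> H" "linear_ext \<chi> (basis_bracket i j) = 0"
      by auto
  qed
  define J where "J = free_alg_scalars.word_hom emb"
  note J_simps = J_def free_alg_scalars.word_hom_diff free_alg_scalars.word_hom_add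
    free_alg_scalars.word_hom_mult free_alg_scalars.word_hom_gen free_alg_scalars.word_hom_scale
    free_alg_scalars.word_hom_one scalar_mult
  show ?thesis
  proof (rule that[of "\<lambda>p. vac (J p)"])
    show "vac (J p) = 0" if "p \<in> env_ideal UNIV" for p
    proof -
      \<comment> \<open>The kernel of \<open>vac\<close> need not be an ideal; the multiples on both sides make the claim inductive.\<close>
      have "\<forall>a b. vac (a * J p * b) = 0"
        using that
      proof (rule env_ideal_least[rotated -1])
        fix r assume "r \<in> env_rels UNIV"
        then show "\<forall>a b. vac (a * J r * b) = 0"
          unfolding env_rels_def by (auto simp: J_simps vac_commutator)
      next
        fix p q :: "sv free_alg" assume *: "\<forall>a b. vac (a * J p * b) = 0"
        show "\<forall>a b. vac (a * J (q * p) * b) = 0" "\<forall>a b. vac (a * J (p * q) * b) = 0"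
          using * by (simp_all add: J_simps) (metis mult.assoc)+
      qed (simp_all add: J_simps distrib_left distrib_right free_alg_scalars.word_hom_zero)
      from this[rule_format, of 1 1] show ?thesis by simp
    qed
    have gen: "vac (J (p * gen (basis i))) = \<chi> i * vac (J p)" if "i \<in> H" for p i
      using vac_right_character[OF that] by (simp add: J_simps)
    show "vac (J (p * gen (basis (Mgen 0)))) = \<xi> * vac (J p)" for p
      using gen[of "Mgen 0" p] by (simp add: H_def \<chi>_def)
    show "vac (J (p * gen x)) = \<psi> x * vac (J p)" if "x \<in> sv_plus" for p x
    proof -
      have "vac (J (p * gen x)) = linear_ext \<chi> x * vac (J p)"
        using that
      proof (induction rule: sv_plus_induct)
        case (step c i y)
        have "vac (J p * emb (basis i)) = \<chi> i * vac (J p)"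
          using vac_right_character[of i "J p"] step(1) by (simp add: H_def)
        with step(3) show ?case
          by (simp add: J_simps distrib_left distrib_right) (simp add: basis_def)
      qed (simp add: J_simps)
      then show ?thesis by (simp add: \<chi>[OF that])
    qed
  qed (simp_all add: J_simps vac_one)
qed

section \<open>Quotients of abelian groups with operators\<close>

text \<open>
  The structure that passes to quotients by stable subgroups. Compatibility with products of
  operators is read off from the formula for the action on tensors (\<open>W_proj_smult\<close>).
\<close>

definition operator_group :: "'r set \<Rightarrow> ('r, 'm, 'e) module_scheme \<Rightarrow> bool" where
  "operator_group A M \<longleftrightarrow> abelian_group M \<and>
     (\<forall>r\<in>A. \<forall>x\<in>carrier M. r \<odot>\<^bsub>M\<^esub> x \<in> carrier M \<and>
        (\<forall>y\<in>carrier M. r \<odot>\<^bsub>M\<^esub> (x \<oplus>\<^bsub>M\<^esub> y) = r \<odot>\<^bsub>M\<^esub> x \<oplus>\<^bsub>M\<^esub> r \<odot>\<^bsub>M\<^esub> y))"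

locale operator_subgroup =
  fixes A :: "'r set" and M :: "('r, 'm, 'e) module_scheme" (structure) and N :: "'m set"
  assumes operator_group: "operator_group A M"
    and subgroup: "additive_subgroup N M"
    and stable: "r \<in> A \<Longrightarrow> x \<in> N \<Longrightarrow> r \<odot> x \<in> N"
begin

sublocale abelian_subgroup N M
  using operator_group subgroup by (intro abelian_subgroupI3) (auto simp: operator_group_def)

lemma smult_closed: "r \<in> A \<Longrightarrow> x \<in> carrier M \<Longrightarrow> r \<odot> x \<in> carrier M"
  and smult_add: "r \<in> A \<Longrightarrow> x \<in> carrier M \<Longrightarrow> y \<in> carrier M \<Longrightarrow> r \<odot> (x \<oplus> y) = r \<odot> x \<oplus> r \<odot> y"
  using operator_group by (auto simp: operator_group_def)

lemma coset_eq_iff: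
  assumes "x \<in> carrier M" "y \<in> carrier M"
  shows "N +> x = N +> y \<longleftrightarrow> x \<ominus> y \<in> N"
proof
  assume "N +> x = N +> y"
  then have "x \<in> N +> y" using a_rcos_self[OF assms(1)] by simp
  then obtain h where "h \<in> N" "x = h \<oplus> y"
    by (auto simp: a_r_coset_def r_coset_def)
  moreover have "h \<in> carrier M" using \<open>h \<in> N\<close> by (rule a_Hcarr)
  ultimately show "x \<ominus> y \<in> N"
    using assms by (simp add: minus_eq a_assoc r_neg)
next
  assume "x \<ominus> y \<in> N"
  then have "x \<ominus> y \<oplus> y \<in> N +> y"
    using assms by (intro a_rcosI a_subset)
  then have "x \<in> N +> y"
    using assms by (simp add: minus_eq a_assoc l_neg)
  then show "N +> x = N +> y"
    using a_repr_independence[OF _ assms(2) a_subgroup] by simp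
qed

lemma carrier_quot: "carrier (quot_module M N) = (+>) N ` carrier M"
  by (auto simp: quot_module_def A_RCOSETS_def')

lemma add_quot:
  "x \<in> carrier M \<Longrightarrow> y \<in> carrier M \<Longrightarrow> (N +> x) \<oplus>\<^bsub>quot_module M N\<^esub> (N +> y) = N +> (x \<oplus> y)"
  by (simp add: quot_module_def a_rcos_sum)

lemma zero_quot: "\<zero>\<^bsub>quot_module M N\<^esub> = N +> \<zero>"
  using a_rcos_const[OF additive_subgroup.zero_closed[OF subgroup]] by (simp add: quot_module_def)

lemma smult_quot:
  assumes "r \<in> A" "x \<in> carrier M"
  shows "r \<odot>\<^bsub>quot_module M N\<^esub> (N +> x) = N +> (r \<odot> x)"
proof -
  have const: "N +> (r \<odot> y) = N +> (r \<odot> x)" if y: "y \<in> N +> x" for y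
  proof -
    obtain h where h: "h \<in> N" "y = h \<oplus> x"
      using y by (auto simp: a_r_coset_def r_coset_def)
    have "r \<odot> y = r \<odot> h \<oplus> r \<odot> x"
      unfolding h(2) by (rule smult_add[OF assms(1) a_Hcarr[OF h(1)] assms(2)])
    then have "r \<odot> y \<in> N +> (r \<odot> x)"
      using a_rcosI[OF stable[OF assms(1) h(1)] a_subset smult_closed[OF assms]] by simp
    then show ?thesis
      using a_repr_independence[OF _ smult_closed[OF assms] a_subgroup] by simp
  qed
  have "(\<Union>y\<in>N +> x. N +> (r \<odot> y)) = N +> (r \<odot> x)"
    by (rule UN_constant_eq[OF a_rcos_self[OF assms(2)]]) (intro ballI const)
  then show ?thesis
    by (simp add: quot_module_def)
qed

lemma abelian_group_quot: "abelian_group (quot_module M N)"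
proof (rule abelian_groupI)
  fix X assume "X \<in> carrier (quot_module M N)"
  then obtain x where "x \<in> carrier M" "X = N +> x"
    by (auto simp: carrier_quot)
  then have "(N +> (\<ominus> x)) \<oplus>\<^bsub>quot_module M N\<^esub> X = \<zero>\<^bsub>quot_module M N\<^esub>"
    using add_quot[of "\<ominus> x" x] l_neg[of x] by (simp add: zero_quot)
  moreover have "N +> (\<ominus> x) \<in> carrier (quot_module M N)"
    using \<open>x \<in> carrier M\<close> by (auto simp: carrier_quot)
  ultimately show "\<exists>Y\<in>carrier (quot_module M N). Y \<oplus>\<^bsub>quot_module M N\<^esub> X = \<zero>\<^bsub>quot_module M N\<^esub>"
    by blast
next
  show "\<zero>\<^bsub>quot_module M N\<^esub> \<in> carrier (quot_module M N)"
    by (simp add: zero_quot carrier_quot)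
next
  fix X Y assume XY: "X \<in> carrier (quot_module M N)" "Y \<in> carrier (quot_module M N)"
  then obtain x y where *: "x \<in> carrier M" "X = N +> x" "y \<in> carrier M" "Y = N +> y"
    unfolding carrier_quot by blast
  then show "X \<oplus>\<^bsub>quot_module M N\<^esub> Y = Y \<oplus>\<^bsub>quot_module M N\<^esub> X"
    by (simp add: add_quot a_comm)
  show "X \<oplus>\<^bsub>quot_module M N\<^esub> Y \<in> carrier (quot_module M N)"
    using * by (simp add: add_quot carrier_quot)
  show "\<zero>\<^bsub>quot_module M N\<^esub> \<oplus>\<^bsub>quot_module M N\<^esub> X = X"
    using * add_quot[of \<zero> x] by (simp add: zero_quot)
  fix Z assume "Z \<in> carrier (quot_module M N)"
  then obtain z where "z \<in> carrier M" "Z = N +> z"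
    unfolding carrier_quot by blast
  with * show "X \<oplus>\<^bsub>quot_module M N\<^esub> Y \<oplus>\<^bsub>quot_module M N\<^esub> Z
      = X \<oplus>\<^bsub>quot_module M N\<^esub> (Y \<oplus>\<^bsub>quot_module M N\<^esub> Z)"
    by (simp add: add_quot a_assoc)
qed

lemma operator_group_quot: "operator_group A (quot_module M N)"
  unfolding operator_group_def
proof (intro conjI ballI abelian_group_quot)
  fix r X assume r: "r \<in> A" and "X \<in> carrier (quot_module M N)"
  then obtain x where x: "x \<in> carrier M" "X = N +> x"
    unfolding carrier_quot by blast
  show "r \<odot>\<^bsub>quot_module M N\<^esub> X \<in> carrier (quot_module M N)"
    unfolding x(2) smult_quot[OF r x(1)] carrier_quot using smult_closed[OF r x(1)] by blast
  fix Y assume "Y \<in> carrier (quot_module M N)"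
  then obtain y where y: "y \<in> carrier M" "Y = N +> y"
    unfolding carrier_quot by blast
  show "r \<odot>\<^bsub>quot_module M N\<^esub> (X \<oplus>\<^bsub>quot_module M N\<^esub> Y) =
      r \<odot>\<^bsub>quot_module M N\<^esub> X \<oplus>\<^bsub>quot_module M N\<^esub> r \<odot>\<^bsub>quot_module M N\<^esub> Y"
    unfolding x(2) y(2) using r x(1) y(1)
    by (simp only: add_quot smult_quot smult_closed smult_add a_closed)
qed

end

section \<open>The universal Whittaker module\<close>

lemma generate_free_Abelian_induct:
  assumes "x \<in> generate (free_Abelian_group S) X" "X \<subseteq> carrier (free_Abelian_group S)"
    and "P 0" "\<And>x. x \<in> X \<Longrightarrow> P x" "\<And>x y. P x \<Longrightarrow> P y \<Longrightarrow> P (x + y)" "\<And>x. P x \<Longrightarrow> P (- x)"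
  shows "P x"
  using assms(1)
proof (induction rule: generate.induct)
  case (inv h)
  then have "Poly_Mapping.keys h \<subseteq> S"
    using assms(2) subsetD carrier_free_Abelian_group_iff by metis
  with inv show ?case using assms by simp
qed (use assms in auto)

definition whittaker_rels :: "(sv \<Rightarrow> complex) \<Rightarrow> (sv free_alg set \<times> complex \<Rightarrow>\<^sub>0 int) set" where
  "whittaker_rels \<psi> = generate (free_Abelian_group (carrier U_sv \<times> carrier (C_mod \<psi>)))
     (tensor_rels U_sv_plus U_sv env_incl (C_mod \<psi>))"

lemma W_mod_eq: "W_mod \<psi> = quot_module (pretensor U_sv (C_mod \<psi>)) (whittaker_rels \<psi>)"
  by (simp add: W_mod_def tensor_def whittaker_rels_def)

lemma env_class_in_carrier [simp]: "env_class UNIV p \<in> carrier U_sv"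
  by (simp add: carrier_env)

lemma env_class_UNIV_ops [simp]:
  "env_class UNIV p \<oplus>\<^bsub>U_sv\<^esub> env_class UNIV q = env_class UNIV (p + q)"
  "env_class UNIV p \<otimes>\<^bsub>U_sv\<^esub> env_class UNIV q = env_class UNIV (p * q)"
  by (simp_all add: env_class_add env_class_mult)

lemma env_class_UNIV_eq [simp]: "env_class UNIV p = env_class UNIV q \<longleftrightarrow> p - q \<in> env_ideal UNIV"
  by (simp add: env_class_eq)

lemma carrier_U_sv: "X \<in> carrier U_sv \<longleftrightarrow> (\<exists>p. X = env_class UNIV p)"
  by (auto simp: carrier_env)

lemma carrier_C_mod [simp]: "carrier (C_mod \<psi>) = UNIV" "\<alpha> \<oplus>\<^bsub>C_mod \<psi>\<^esub> \<beta> = \<alpha> + \<beta>"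
  by (simp_all add: C_mod_def)

context
  fixes \<psi> :: "sv \<Rightarrow> complex"
  assumes \<psi>: "lie_hom_plus \<psi>"
begin

abbreviation (input) tens :: "sv free_alg \<Rightarrow> complex \<Rightarrow> (sv free_alg set \<times> complex \<Rightarrow>\<^sub>0 int)" where
  "tens p \<alpha> \<equiv> frag_of (env_class UNIV p, \<alpha>)"

lemma tensor_rels_cases:
  assumes "r \<in> tensor_rels U_sv_plus U_sv env_incl (C_mod \<psi>)"
  obtains (left) p q \<alpha> where "r = tens (p + q) \<alpha> - tens p \<alpha> - tens q \<alpha>"
  | (right) p \<alpha> \<beta> where "r = tens p (\<alpha> + \<beta>) - tens p \<alpha> - tens p \<beta>"
  | (balance) p h \<alpha> where "h \<in> carrier (free_alg sv_plus)"
      "r = tens (p * h) \<alpha> - tens p (psi_ext \<psi> h * \<alpha>)"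
  using assms unfolding tensor_rels_def
  by (auto simp: carrier_U_sv carrier_env[of sv_plus] env_incl_class C_mod_smult[OF \<psi>])

lemma tensor_rels_intros:
  "tens (p + q) \<alpha> - tens p \<alpha> - tens q \<alpha> \<in> tensor_rels U_sv_plus U_sv env_incl (C_mod \<psi>)"
  "tens p (\<alpha> + \<beta>) - tens p \<alpha> - tens p \<beta> \<in> tensor_rels U_sv_plus U_sv env_incl (C_mod \<psi>)"
  "h \<in> carrier (free_alg sv_plus) \<Longrightarrow> tens (p * h) \<alpha> - tens p (psi_ext \<psi> h * \<alpha>)
     \<in> tensor_rels U_sv_plus U_sv env_incl (C_mod \<psi>)"
proof -
  show "tens (p + q) \<alpha> - tens p \<alpha> - tens q \<alpha> \<in> tensor_rels U_sv_plus U_sv env_incl (C_mod \<psi>)"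
    unfolding tensor_rels_def
    by (intro UnI1 CollectI exI[of _ "env_class UNIV p"] exI[of _ "env_class UNIV q"] exI[of _ \<alpha>]) simp
  show "tens p (\<alpha> + \<beta>) - tens p \<alpha> - tens p \<beta> \<in> tensor_rels U_sv_plus U_sv env_incl (C_mod \<psi>)"
    unfolding tensor_rels_def
    by (rule UnI1, rule UnI2, intro CollectI exI[of _ "env_class UNIV p"] exI[of _ \<beta>] exI[of _ \<alpha>]) simp
  assume "h \<in> carrier (free_alg sv_plus)"
  then show "tens (p * h) \<alpha> - tens p (psi_ext \<psi> h * \<alpha>) \<in> tensor_rels U_sv_plus U_sv env_incl (C_mod \<psi>)"
    unfolding tensor_rels_def
    by (intro UnI2 CollectI exI[of _ "env_class UNIV p"] exI[of _ "env_class sv_plus h"] exI[of _ \<alpha>])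
      (simp add: env_incl_class C_mod_smult[OF \<psi>] carrier_env[of sv_plus])
qed

lemma tensor_rels_carrier:
  "tensor_rels U_sv_plus U_sv env_incl (C_mod \<psi>)
     \<subseteq> carrier (free_Abelian_group (carrier U_sv \<times> carrier (C_mod \<psi>)))"
proof
  fix r assume "r \<in> tensor_rels U_sv_plus U_sv env_incl (C_mod \<psi>)"
  then show "r \<in> carrier (free_Abelian_group (carrier U_sv \<times> carrier (C_mod \<psi>)))"
    by (cases rule: tensor_rels_cases) (auto dest!: subsetD[OF keys_diff] split: if_splits)
qed

lemma pretensor_ops [simp]:
  "x \<in> carrier (pretensor U_sv (C_mod \<psi>)) \<longleftrightarrow> Poly_Mapping.keys x \<subseteq> carrier U_sv \<times> UNIV"
  "x \<oplus>\<^bsub>pretensor U_sv (C_mod \<psi>)\<^esub> y = x + y"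
  "\<zero>\<^bsub>pretensor U_sv (C_mod \<psi>)\<^esub> = 0"
  by (simp_all add: pretensor_def)

lemma abelian_group_pretensor: "abelian_group (pretensor U_sv (C_mod \<psi>))"
proof (rule abelian_groupI)
  fix x assume "x \<in> carrier (pretensor U_sv (C_mod \<psi>))"
  then show "\<exists>y\<in>carrier (pretensor U_sv (C_mod \<psi>)).
      y \<oplus>\<^bsub>pretensor U_sv (C_mod \<psi>)\<^esub> x = \<zero>\<^bsub>pretensor U_sv (C_mod \<psi>)\<^esub>"
    by (intro bexI[of _ "- x"]) auto
qed (auto simp: add_ac dest!: subsetD[OF Poly_Mapping.keys_add])

lemma minus_pretensor [simp]:
  assumes "Poly_Mapping.keys x \<subseteq> carrier U_sv \<times> UNIV"
  shows "\<ominus>\<^bsub>pretensor U_sv (C_mod \<psi>)\<^esub> x = - x"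
proof -
  interpret abelian_group "pretensor U_sv (C_mod \<psi>)"
    by (rule abelian_group_pretensor)
  show ?thesis
    using assms by (intro minus_equality) auto
qed

lemma whittaker_rels_closed:
  shows whittaker_rels_carrier: "x \<in> whittaker_rels \<psi> \<Longrightarrow> Poly_Mapping.keys x \<subseteq> carrier U_sv \<times> UNIV"
    and whittaker_rels_zero: "0 \<in> whittaker_rels \<psi>"
    and whittaker_rels_add: "x \<in> whittaker_rels \<psi> \<Longrightarrow> y \<in> whittaker_rels \<psi> \<Longrightarrow> x + y \<in> whittaker_rels \<psi>"
    and whittaker_rels_uminus: "x \<in> whittaker_rels \<psi> \<Longrightarrow> - x \<in> whittaker_rels \<psi>"
proof -
  have sub: "subgroup (whittaker_rels \<psi>) (free_Abelian_group (carrier U_sv \<times> UNIV))"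
    using group.generate_is_subgroup[OF group_free_Abelian_group tensor_rels_carrier]
    by (simp add: whittaker_rels_def)
  note s = subgroup.mem_carrier[OF sub] subgroup.one_closed[OF sub] subgroup.m_closed[OF sub]
    subgroup.m_inv_closed[OF sub]
  show car: "Poly_Mapping.keys x \<subseteq> carrier U_sv \<times> UNIV" if "x \<in> whittaker_rels \<psi>" for x
    using s(1)[OF that] by simp
  show "0 \<in> whittaker_rels \<psi>"
    using s(2) by simp
  show "x + y \<in> whittaker_rels \<psi>" if "x \<in> whittaker_rels \<psi>" "y \<in> whittaker_rels \<psi>" for x y
    using s(3)[OF that] by simp
  show "- x \<in> whittaker_rels \<psi>" if "x \<in> whittaker_rels \<psi>"
    using s(4)[OF that] car[OF that] by simp
qed

lemma additive_subgroup_whittaker_rels: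
  "additive_subgroup (whittaker_rels \<psi>) (pretensor U_sv (C_mod \<psi>))"
proof -
  interpret abelian_group "pretensor U_sv (C_mod \<psi>)"
    by (rule abelian_group_pretensor)
  have "subgroup (whittaker_rels \<psi>) (add_monoid (pretensor U_sv (C_mod \<psi>)))"
    by (rule add.subgroupI)
      (auto simp: whittaker_rels_add whittaker_rels_uminus whittaker_rels_carrier
        intro: whittaker_rels_zero dest: subsetD[OF whittaker_rels_carrier])
  then show ?thesis by (rule additive_subgroup.intro)
qed

lemma smult_pretensor_tens [simp]:
  "env_class UNIV s \<odot>\<^bsub>pretensor U_sv (C_mod \<psi>)\<^esub> tens p \<alpha> = tens (s * p) \<alpha>"
  by (simp add: pretensor_def)

lemma smult_pretensor_additive:
  "X \<odot>\<^bsub>pretensor U_sv (C_mod \<psi>)\<^esub> (x + y) =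
     X \<odot>\<^bsub>pretensor U_sv (C_mod \<psi>)\<^esub> x + X \<odot>\<^bsub>pretensor U_sv (C_mod \<psi>)\<^esub> y"
  "X \<odot>\<^bsub>pretensor U_sv (C_mod \<psi>)\<^esub> (x - y) =
     X \<odot>\<^bsub>pretensor U_sv (C_mod \<psi>)\<^esub> x - X \<odot>\<^bsub>pretensor U_sv (C_mod \<psi>)\<^esub> y"
  "X \<odot>\<^bsub>pretensor U_sv (C_mod \<psi>)\<^esub> (- x) = - (X \<odot>\<^bsub>pretensor U_sv (C_mod \<psi>)\<^esub> x)"
  "X \<odot>\<^bsub>pretensor U_sv (C_mod \<psi>)\<^esub> 0 = 0"
  by (simp_all add: pretensor_def frag_extend_add frag_extend_diff frag_extend_minus)

lemma operator_group_pretensor: "operator_group (carrier U_sv) (pretensor U_sv (C_mod \<psi>))"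
  unfolding operator_group_def
proof (intro conjI ballI)
  show "abelian_group (pretensor U_sv (C_mod \<psi>))"
    by (rule abelian_group_pretensor)
  interpret U: ring U_sv by (simp add: ring_env)
  fix X c assume X: "X \<in> carrier U_sv" and "c \<in> carrier (pretensor U_sv (C_mod \<psi>))"
  then have "Poly_Mapping.keys c \<subseteq> carrier U_sv \<times> UNIV"
    by (simp add: pretensor_def)
  then show "X \<odot>\<^bsub>pretensor U_sv (C_mod \<psi>)\<^esub> c \<in> carrier (pretensor U_sv (C_mod \<psi>))"
    using X keys_frag_extend[of "\<lambda>(a', b). frag_of (X \<otimes>\<^bsub>U_sv\<^esub> a', b)" c]
    by (fastforce simp: pretensor_def split: prod.splits if_splits)
next
  show "X \<odot>\<^bsub>pretensor U_sv (C_mod \<psi>)\<^esub> (c \<oplus>\<^bsub>pretensor U_sv (C_mod \<psi>)\<^esub> d) =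
    X \<odot>\<^bsub>pretensor U_sv (C_mod \<psi>)\<^esub> c \<oplus>\<^bsub>pretensor U_sv (C_mod \<psi>)\<^esub> X \<odot>\<^bsub>pretensor U_sv (C_mod \<psi>)\<^esub> d" for X c d
    using smult_pretensor_additive(1)[of X c d] by (simp add: pretensor_def)
qed

lemma smult_whittaker_rels:
  assumes "X \<in> carrier U_sv" "c \<in> whittaker_rels \<psi>"
  shows "X \<odot>\<^bsub>pretensor U_sv (C_mod \<psi>)\<^esub> c \<in> whittaker_rels \<psi>"
proof -
  obtain s where X: "X = env_class UNIV s"
    using assms(1) by (auto simp: carrier_U_sv)
  from assms(2)[unfolded whittaker_rels_def] show ?thesis
  proof (rule generate_free_Abelian_induct[OF _ tensor_rels_carrier])
    fix r assume "r \<in> tensor_rels U_sv_plus U_sv env_incl (C_mod \<psi>)"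
    then have "X \<odot>\<^bsub>pretensor U_sv (C_mod \<psi>)\<^esub> r \<in> tensor_rels U_sv_plus U_sv env_incl (C_mod \<psi>)"
      by (cases rule: tensor_rels_cases)
        (auto simp: X smult_pretensor_additive distrib_left mult.assoc[symmetric] intro!: tensor_rels_intros)
    then show "X \<odot>\<^bsub>pretensor U_sv (C_mod \<psi>)\<^esub> r \<in> whittaker_rels \<psi>"
      unfolding whittaker_rels_def by (rule generate.incl)
  qed (simp_all add: smult_pretensor_additive whittaker_rels_zero whittaker_rels_add whittaker_rels_uminus)
qed

lemma operator_subgroup_whittaker_rels:
  "operator_subgroup (carrier U_sv) (pretensor U_sv (C_mod \<psi>)) (whittaker_rels \<psi>)"
  by (intro operator_subgroup.intro operator_group_pretensor smult_whittaker_rels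
      additive_subgroup_whittaker_rels)

text \<open>
  The class of \<open>p \<otimes> 1\<close>. Since scalars can be moved across the tensor sign, these classes exhaust the
  module, which lets computations in \<open>W_mod\<close> be replaced by computations in the free algebra.
\<close>

definition W_proj :: "sv free_alg \<Rightarrow> W_elem" where
  "W_proj p = whittaker_rels \<psi> +>\<^bsub>pretensor U_sv (C_mod \<psi>)\<^esub> tens p 1"

interpretation W: operator_subgroup "carrier U_sv" "pretensor U_sv (C_mod \<psi>)" "whittaker_rels \<psi>"
  by (rule operator_subgroup_whittaker_rels)

lemma tens_carrier [simp]: "tens p \<alpha> \<in> carrier (pretensor U_sv (C_mod \<psi>))"
  by simp

lemma coset_eqI:
  assumes "x - y \<in> whittaker_rels \<psi>" "x \<in> carrier (pretensor U_sv (C_mod \<psi>))"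
    "y \<in> carrier (pretensor U_sv (C_mod \<psi>))"
  shows "whittaker_rels \<psi> +>\<^bsub>pretensor U_sv (C_mod \<psi>)\<^esub> x
    = whittaker_rels \<psi> +>\<^bsub>pretensor U_sv (C_mod \<psi>)\<^esub> y"
  using assms by (subst W.coset_eq_iff) (simp_all add: W.minus_eq)

lemma W_proj_carrier: "W_proj p \<in> carrier (W_mod \<psi>)"
  by (simp add: W_proj_def W_mod_eq W.carrier_quot del: pretensor_ops)

lemma W_proj_eqI: "p - q \<in> env_ideal UNIV \<Longrightarrow> W_proj p = W_proj q"
  by (metis W_proj_def env_class_UNIV_eq)

lemma W_proj_add: "W_proj (p + q) = W_proj p \<oplus>\<^bsub>W_mod \<psi>\<^esub> W_proj q"
proof -
  have "tens (p + q) 1 - (tens p 1 + tens q 1) \<in> whittaker_rels \<psi>"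
    using generate.incl[OF tensor_rels_intros(1)[of p q 1]]
    by (simp add: whittaker_rels_def diff_diff_eq)
  then have "W_proj (p + q) = whittaker_rels \<psi> +>\<^bsub>pretensor U_sv (C_mod \<psi>)\<^esub> (tens p 1 + tens q 1)"
    unfolding W_proj_def using W.a_closed[OF tens_carrier[of p 1] tens_carrier[of q 1]]
    by (intro coset_eqI) (simp_all del: pretensor_ops(1))
  then show ?thesis
    using W.add_quot[of "tens p 1" "tens q 1"] by (simp add: W_proj_def W_mod_eq)
qed

lemma W_proj_smult: "env_class UNIV s \<odot>\<^bsub>W_mod \<psi>\<^esub> W_proj p = W_proj (s * p)"
  using W.smult_quot[of "env_class UNIV s" "tens p 1"] by (simp add: W_proj_def W_mod_eq)

lemma W_proj_balance:
  assumes "h \<in> carrier (free_alg sv_plus)"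
  shows "W_proj (p * h) = whittaker_rels \<psi> +>\<^bsub>pretensor U_sv (C_mod \<psi>)\<^esub> tens p (psi_ext \<psi> h)"
  unfolding W_proj_def
  using generate.incl[OF tensor_rels_intros(3)[OF assms, of p 1]]
  by (intro coset_eqI) (simp_all add: whittaker_rels_def)

lemma W_proj_scale:
  "W_proj (pm_scale \<alpha> p) = whittaker_rels \<psi> +>\<^bsub>pretensor U_sv (C_mod \<psi>)\<^esub> tens p \<alpha>"
  using W_proj_balance[of "pm_scale \<alpha> 1" p]
  by (simp add: free_alg_closed psi_ext_eq complex_scalars.word_hom_scale complex_scalars.word_hom_one)

lemma W_proj_character:
  assumes "x \<in> sv_plus"
  shows "W_proj (p * gen x) = W_proj (pm_scale (\<psi> x) p)"
  using W_proj_balance[of "gen x" p] assms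
  by (simp add: W_proj_scale free_alg_closed psi_ext_eq complex_scalars.word_hom_gen)

lemma operator_group_W: "operator_group (carrier U_sv) (W_mod \<psi>)"
  unfolding W_mod_eq by (rule W.operator_group_quot)

text \<open>
  It suffices to reach single tensors, and \<open>p \<otimes> \<alpha>\<close> is the class of \<open>\<alpha> p \<otimes> 1\<close>.
\<close>

lemma W_proj_surj:
  assumes "w \<in> carrier (W_mod \<psi>)"
  obtains p where "w = W_proj p"
proof -
  interpret WW: abelian_group "W_mod \<psi>"
    using operator_group_W by (simp add: operator_group_def)
  let ?c = "\<lambda>c. whittaker_rels \<psi> +>\<^bsub>pretensor U_sv (C_mod \<psi>)\<^esub> c"
  obtain c where c: "c \<in> carrier (pretensor U_sv (C_mod \<psi>))" "w = ?c c"
    using assms by (auto simp: W_mod_eq W.carrier_quot simp del: pretensor_ops)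
  have "\<exists>p. ?c c = W_proj p \<and> Poly_Mapping.keys c \<subseteq> carrier U_sv \<times> UNIV"
    using c(1)[unfolded pretensor_ops]
  proof (induction rule: frag_induction)
    case zero
    have "W_proj 0 \<oplus>\<^bsub>W_mod \<psi>\<^esub> W_proj 0 = W_proj 0"
      using W_proj_add[of 0 0] by simp
    then have "W_proj 0 = \<zero>\<^bsub>W_mod \<psi>\<^esub>"
      using W_proj_carrier WW.add.l_cancel_one by blast
    then show ?case
      using W.zero_quot by (auto simp: W_mod_eq)
  next
    case (one t)
    then obtain p \<alpha> where "t = (env_class UNIV p, \<alpha>)"
      by (metis carrier_U_sv mem_Sigma_iff surj_pair)
    then show ?case using W_proj_scale[of \<alpha> p, symmetric] by auto
  next
    case (diff x y)
    then obtain p q where pq: "?c x = W_proj p" "?c y = W_proj q" 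
      and k: "Poly_Mapping.keys x \<subseteq> carrier U_sv \<times> UNIV" "Poly_Mapping.keys y \<subseteq> carrier U_sv \<times> UNIV"
      by auto
    have k': "Poly_Mapping.keys (x - y) \<subseteq> carrier U_sv \<times> UNIV"
      using k keys_diff[of x y] by auto
    have "?c (x - y) \<oplus>\<^bsub>W_mod \<psi>\<^esub> ?c y = ?c x"
      using W.add_quot[of "x - y" y] k k' by (simp add: W_mod_eq)
    moreover have "W_proj (p - q) \<oplus>\<^bsub>W_mod \<psi>\<^esub> W_proj q = W_proj p"
      using W_proj_add[of "p - q" q] by simp
    moreover have "?c (x - y) \<in> carrier (W_mod \<psi>)"
      using k' by (simp add: W_mod_eq W.carrier_quot)
    ultimately show ?case
      using pq k' W_proj_carrier by (metis WW.add.right_cancel)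
  qed
  with c that show ?thesis by blast
qed

text \<open>
  The universal property of the tensor product: \<open>p \<otimes> \<alpha> \<mapsto> \<alpha> \<Phi> p\<close> respects all relations, so a
  functional with the listed properties factors through \<open>W_proj\<close>.
\<close>

lemma W_proj_functional:
  assumes add: "\<And>p q. \<Phi> (p + q) = \<Phi> p + \<Phi> q" and scale: "\<And>c p. \<Phi> (pm_scale c p) = c * \<Phi> p"
    and ideal: "\<And>p. p \<in> env_ideal UNIV \<Longrightarrow> \<Phi> p = (0 :: complex)"
    and char: "\<And>p x. x \<in> sv_plus \<Longrightarrow> \<Phi> (p * gen x) = \<psi> x * \<Phi> p"
    and eq: "W_proj p = W_proj q"
  shows "\<Phi> p = \<Phi> q"
proof -
  have diff: "\<Phi> (p - q) = \<Phi> p - \<Phi> q" for p q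
    by (rule additive_diff) (rule add)
  have hom: "\<Phi> (p * h) = psi_ext \<psi> h * \<Phi> p" if "h \<in> carrier (free_alg sv_plus)" for p h
  proof -
    have word: "\<Phi> (p * monomial w) = prod_list (map \<psi> w) * \<Phi> p" if "set w \<subseteq> sv_plus" for w p
      using that
    proof (induction w arbitrary: p)
      case (Cons x w)
      then show ?case
        using Cons.IH[of "p * gen x"] by (simp add: monomial_Cons mult.assoc char)
    qed simp
    have sum: "\<Phi> (sum f K) = (\<Sum>k\<in>K. \<Phi> (f k))" for f :: "sv word \<Rightarrow> sv free_alg" and K
      by (induction K rule: infinite_finite_induct) (simp_all add: add additive_zero[OF add])
    have h: "h = (\<Sum>w\<in>Poly_Mapping.keys h. pm_scale (Poly_Mapping.lookup h w) (monomial (letters w)))"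
      by (simp add: monomial_def flip: poly_mapping_expand)
    have "\<Phi> (p * h) = (\<Sum>w\<in>Poly_Mapping.keys h. \<Phi> (pm_scale (Poly_Mapping.lookup h w) (p * monomial (letters w))))"
      using arg_cong[OF h, of "\<lambda>h. \<Phi> (p * h)"] by (simp only: sum_distrib_left pm_scale_mult_right sum)
    also have "\<dots> = (\<Sum>w\<in>Poly_Mapping.keys h. Poly_Mapping.lookup h w * (prod_list (map \<psi> (letters w)) * \<Phi> p))"
      using that by (intro sum.cong refl) (auto simp: scale word carrier_free_alg)
    finally show ?thesis
      by (simp add: psi_ext_def sum_distrib_right mult.assoc)
  qed
  \<comment> \<open>\<open>\<Phi>\<close> is constant on classes in the enveloping algebra, so it induces \<open>\<tau>\<close> there.\<close>
  define \<tau> where "\<tau> X = the_elem (\<Phi> ` X)" for X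
  have \<tau>: "\<tau> (env_class UNIV p) = \<Phi> p" for p
  proof -
    have "\<Phi> q = \<Phi> p" if "q \<in> env_class UNIV p" for q
      using ideal[of "q - p"] that by (simp add: mem_env_class diff)
    moreover have "p \<in> env_class UNIV p"
      by (simp add: mem_env_class env_ideal_zero)
    ultimately have "\<Phi> ` env_class UNIV p = {\<Phi> p}"
      by blast
    then show ?thesis by (simp add: \<tau>_def)
  qed
  define F :: "(sv free_alg set \<times> complex \<Rightarrow>\<^sub>0 int) \<Rightarrow> complex"
    where "F = additive_ext (\<lambda>(X, \<alpha>) n. of_int n * (\<alpha> * \<tau> X))"
  have F_add: "F (x + y) = F x + F y" for x y
    unfolding F_def by (rule additive_ext_add) (auto simp: distrib_right)
  note F_diff = additive_diff[of F, OF F_add]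
  have F_tens: "F (tens p \<alpha>) = \<alpha> * \<Phi> p" for p \<alpha>
    unfolding F_def by (subst additive_ext_single) (simp_all add: \<tau>)
  have F_rels: "F r = 0" if "r \<in> whittaker_rels \<psi>" for r
    using that[unfolded whittaker_rels_def]
  proof (rule generate_free_Abelian_induct[OF _ tensor_rels_carrier])
    fix r assume "r \<in> tensor_rels U_sv_plus U_sv env_incl (C_mod \<psi>)"
    then show "F r = 0"
      by (cases rule: tensor_rels_cases) (simp_all add: F_diff F_tens add hom distrib_left distrib_right)
  next
    show "F (- x) = 0" if "F x = 0" for x
      using F_diff[of 0 x] that additive_zero[of F, OF F_add] by simp
  qed (simp_all add: F_add additive_zero[of F, OF F_add])
  have "tens p 1 - tens q 1 \<in> whittaker_rels \<psi>"
    using eq unfolding W_proj_def by (subst (asm) W.coset_eq_iff) (simp_all add: W.minus_eq)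
  from F_rels[OF this] show ?thesis
    by (simp add: F_diff F_tens)
qed

end

section \<open>Local nilpotency of the shifted positive part\<close>

text \<open>
  If the bracket vanishes, the coefficient is 0 and \<open>k\<close> is any index of the right degree.
\<close>

lemma basis_bracket_homogeneous:
  obtains c k where "basis_bracket h i = pm_scale c (basis k)" "deg k = deg h + deg i"
proof -
  have "\<exists>c k. basis_bracket h i = pm_scale c (basis k) \<and> deg k = deg h + deg i"
  proof (cases "basis_bracket h i = 0")
    case True
    have "\<exists>k. deg k = d" for d
    proof (cases "even d")
      case True
      then have "deg (Lgen (d div 2)) = d" by simp
      then show ?thesis ..
    next
      case False
      then have "deg (Ygen (d div 2)) = d" by simp
      then show ?thesis ..
    qed
    then obtain k where "deg k = deg h + deg i" by blast
    moreover have "basis_bracket h i = pm_scale 0 (basis k)"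
      using True by simp
    ultimately show ?thesis by blast
  next
    case False
    have neg: "- pm_scale c x = pm_scale (- c) x" for c and x :: sv
      by simp
    have "basis_bracket h i = 0 \<or>
        (\<exists>c k. basis_bracket h i = pm_scale c (basis k) \<and> deg k = deg h + deg i)"
      by (cases h; cases i; simp only: basis_bracket.simps neg;
          ((rule disjI1, rule refl) |
           (rule disjI2, rule exI, rule exI, rule conjI, rule refl, simp))?)
    with False show ?thesis by blast
  qed
  with that show ?thesis by blast
qed

lemma gen_relations:
  shows gen_add: "gen (x + y) - gen x - gen y \<in> env_ideal UNIV"
    and gen_scale: "gen (pm_scale c x) - pm_scale c (gen x) \<in> env_ideal UNIV"
    and gen_bracket: "gen x * gen y - gen y * gen x - gen (bracket x y) \<in> env_ideal UNIV"
  by (rule env_ideal_rels, simp, unfold env_rels_def, blast)+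

lemma gen_zero: "gen 0 \<in> env_ideal UNIV"
  using gen_scale[of 0 0] by simp

text \<open>
  The words in the basis of \<open>sv\<close>, as opposed to words in arbitrary elements of \<open>sv\<close>.
\<close>

definition basis_monomial :: "sv_index list \<Rightarrow> sv free_alg" where
  "basis_monomial w = monomial (map basis w)"

lemma basis_monomial_simps: "basis_monomial [] = 1" "basis_monomial (i # w) = gen (basis i) * basis_monomial w"
  "basis_monomial (u @ v) = basis_monomial u * basis_monomial v"
  by (simp_all add: basis_monomial_def monomial_Cons monomial_append)

text \<open>
  The annihilator in the free algebra of a Whittaker vector of type \<open>\<psi>\<close>: a left ideal that
  contains the relations of the enveloping algebra. Congruence modulo \<open>K\<close> is equality in the module
  generated by this vector.
\<close>

locale whittaker_kernel =
  fixes \<psi> :: "sv \<Rightarrow> complex" and K :: "sv free_alg set"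
  assumes K_add: "p \<in> K \<Longrightarrow> q \<in> K \<Longrightarrow> p + q \<in> K"
    and K_left: "p \<in> K \<Longrightarrow> s * p \<in> K"
    and K_ideal: "p \<in> env_ideal UNIV \<Longrightarrow> p \<in> K"
    and K_character: "x \<in> sv_plus \<Longrightarrow> p * gen x - pm_scale (\<psi> x) p \<in> K"
begin

lemma K_scale: "p \<in> K \<Longrightarrow> pm_scale c p \<in> K"
  using K_left[of p "scalar c"] by (simp add: scalar_mult)

definition subspace_over :: "sv free_alg set \<Rightarrow> bool" where
  "subspace_over Q \<longleftrightarrow> K \<subseteq> Q \<and> (\<forall>p\<in>Q. \<forall>q\<in>Q. p + q \<in> Q) \<and> (\<forall>c. \<forall>p\<in>Q. pm_scale c p \<in> Q)"

lemma subspace_overD: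
  assumes "subspace_over Q"
  shows "p \<in> K \<Longrightarrow> p \<in> Q" "p \<in> Q \<Longrightarrow> q \<in> Q \<Longrightarrow> p + q \<in> Q" "p \<in> Q \<Longrightarrow> pm_scale c p \<in> Q"
  using assms unfolding subspace_over_def by blast+

lemma subspace_over_cong:
  assumes "subspace_over Q" "p - q \<in> K" "q \<in> Q"
  shows "p \<in> Q"
  using subspace_overD(2)[OF assms(1) subspace_overD(1)[OF assms(1,2)] assms(3)] by simp

text \<open>
  Commuting a basis element past a word is a derivation: the result is a combination of words in
  which one letter is replaced by a letter whose degree is larger by the degree of the basis element.
\<close>

lemma commutator_mem:
  assumes Q: "subspace_over Q"
    and words: "\<And>u i v k. w = u @ i # v \<Longrightarrow> deg k = deg h + deg i \<Longrightarrow> basis_monomial (p @ u @ k # v) \<in> Q"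
  shows "basis_monomial p * (gen (basis h) * basis_monomial w - basis_monomial w * gen (basis h)) \<in> Q"
  using words
proof (induction w arbitrary: p)
  case Nil
  then show ?case
    using subspace_overD(1)[OF Q K_ideal[OF env_ideal_zero]] by (simp add: basis_monomial_simps)
next
  case (Cons i w)
  let ?h = "gen (basis h)" and ?i = "gen (basis i)"
  obtain c k where k: "basis_bracket h i = pm_scale c (basis k)" "deg k = deg h + deg i"
    by (rule basis_bracket_homogeneous)
  have rest: "basis_monomial (p @ [i]) * (?h * basis_monomial w - basis_monomial w * ?h) \<in> Q"
  proof (rule Cons.IH)
    fix u j v l assume "w = u @ j # v" "deg l = deg h + deg j"
    then show "basis_monomial ((p @ [i]) @ u @ l # v) \<in> Q"
      using Cons.prems[of "i # u" j v l] by simp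
  qed
  have "?h * ?i - ?i * ?h - pm_scale c (gen (basis k)) \<in> env_ideal UNIV"
    using env_ideal_add[OF closed_under_ops_UNIV gen_bracket[of "basis h" "basis i"] gen_scale[of c "basis k"]]
    by (simp add: k)
  then have "basis_monomial p * (?h * ?i - ?i * ?h - pm_scale c (gen (basis k))) * basis_monomial w \<in> K"
    by (intro K_ideal env_ideal_mult) simp_all
  moreover have "basis_monomial p * (?h * ?i - ?i * ?h - pm_scale c (gen (basis k))) * basis_monomial w
      = basis_monomial p * (?h * ?i - ?i * ?h) * basis_monomial w - pm_scale c (basis_monomial (p @ k # w))"
    by (simp add: basis_monomial_simps left_diff_distrib right_diff_distrib mult.assoc)
  moreover have "pm_scale c (basis_monomial (p @ k # w)) \<in> Q"
    using Cons.prems[of "[]" i w k] k(2) by (intro subspace_overD(3)[OF Q]) simp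
  ultimately have "basis_monomial p * (?h * ?i - ?i * ?h) * basis_monomial w \<in> Q"
    using subspace_over_cong[OF Q] by simp
  moreover have "basis_monomial p * (?h * basis_monomial (i # w) - basis_monomial (i # w) * ?h) =
      basis_monomial p * (?h * ?i - ?i * ?h) * basis_monomial w + basis_monomial (p @ [i]) * (?h * basis_monomial w - basis_monomial w * ?h)"
    by (simp add: basis_monomial_simps left_diff_distrib right_diff_distrib mult.assoc)
  ultimately show ?case
    using subspace_overD(2)[OF Q _ rest] by simp
qed

text \<open>
  Moving the letter to the right end costs words with one letter less, and at the right end it is a
  scalar modulo \<open>K\<close>.
\<close>

lemma positive_letter:
  assumes Q: "subspace_over Q" and "deg h > 0"
    and shorter: "\<And>w. length w = length u + length v \<Longrightarrow> basis_monomial w \<in> Q"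
  shows "basis_monomial (u @ h # v) \<in> Q"
proof -
  have 1: "basis_monomial u * (gen (basis h) * basis_monomial v - basis_monomial v * gen (basis h)) \<in> Q"
    by (intro commutator_mem[OF Q] shorter) auto
  have "basis_monomial (u @ v) * gen (basis h) - pm_scale (\<psi> (basis h)) (basis_monomial (u @ v)) \<in> K"
    using K_character basis_sv_plus \<open>deg h > 0\<close> by blast
  moreover have "pm_scale (\<psi> (basis h)) (basis_monomial (u @ v)) \<in> Q"
    by (intro subspace_overD(3)[OF Q] shorter) simp
  ultimately have "basis_monomial (u @ v) * gen (basis h) \<in> Q"
    by (rule subspace_over_cong[OF Q])
  moreover have "basis_monomial (u @ h # v) =
      basis_monomial u * (gen (basis h) * basis_monomial v - basis_monomial v * gen (basis h)) + basis_monomial (u @ v) * gen (basis h)"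
    by (simp add: basis_monomial_simps left_diff_distrib right_diff_distrib mult.assoc)
  ultimately show ?thesis
    using subspace_overD(2)[OF Q 1] by simp
qed

lemma subspace_over_words:
  assumes Q: "subspace_over Q" and words: "\<And>w. basis_monomial w \<in> Q"
  shows "q \<in> Q"
proof -
  have "basis_monomial u * monomial xs \<in> Q" for u xs
  proof (induction xs arbitrary: u)
    case Nil
    then show ?case by (simp add: words)
  next
    case (Cons x xs)
    have E: "e \<in> env_ideal UNIV \<Longrightarrow> basis_monomial u * (e * monomial xs) \<in> K" for e
      by (intro K_ideal env_ideal_mult) simp_all
    have "basis_monomial u * (gen x * monomial xs) \<in> Q"
    proof (induction x rule: sv_induct)
      case zero
      show ?case using E[OF gen_zero] by (rule subspace_overD(1)[OF Q])
    next
      case (scale c i)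
      have "pm_scale c (basis_monomial (u @ [i]) * monomial xs) \<in> Q"
        by (intro subspace_overD(3)[OF Q] Cons)
      moreover have "basis_monomial u * (gen (pm_scale c (basis i)) * monomial xs) - pm_scale c (basis_monomial (u @ [i]) * monomial xs) \<in> K"
        using E[OF gen_scale[of c "basis i"]] by (simp add: basis_monomial_simps left_diff_distrib right_diff_distrib mult.assoc)
      ultimately show ?case by (rule subspace_over_cong[OF Q, rotated])
    next
      case (add x y)
      then have "basis_monomial u * (gen x * monomial xs) + basis_monomial u * (gen y * monomial xs) \<in> Q"
        by (rule subspace_overD(2)[OF Q])
      moreover have "basis_monomial u * (gen (x + y) * monomial xs) - (basis_monomial u * (gen x * monomial xs) + basis_monomial u * (gen y * monomial xs)) \<in> K"
        using E[OF gen_add[of x y]] by (simp add: left_diff_distrib right_diff_distrib distrib_left distrib_right diff_diff_eq)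
      ultimately show ?case by (rule subspace_over_cong[OF Q, rotated])
    qed
    then show ?case by (simp add: monomial_Cons)
  qed
  from this[of "[]"] have *: "monomial xs \<in> Q" for xs
    by (simp add: basis_monomial_simps)
  show ?thesis
  proof (induction q rule: single_add_induct)
    case (single k c)
    have "Poly_Mapping.single k c = pm_scale c (monomial (letters k))"
      by (simp add: monomial_def)
    then show ?case using subspace_overD(3)[OF Q *] by simp
  qed (rule subspace_overD(2)[OF Q])
qed

text \<open>
  The vectors killed by some power of \<open>z = x - \<psi> x\<close> form a subspace that contains \<open>K\<close> and every
  \<open>q\<close> with \<open>z q\<close> in it. All words lie in it by induction on the length and then on the sum of the
  negated degrees: a word with a letter of positive degree reduces to shorter words, and on any other
  word \<open>z\<close> acts as the commutator with \<open>x\<close>, which raises degrees.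
\<close>

theorem locally_nilpotent:
  assumes "deg h > 0"
  shows "\<exists>n. (gen (basis h) - pm_scale (\<psi> (basis h)) 1) ^ n * q \<in> K"
proof -
  define z where "z = gen (basis h) - pm_scale (\<psi> (basis h)) 1"
  define Q where "Q = {q. \<exists>n. z ^ n * q \<in> K}"
  have Q_K: "q \<in> Q" if "q \<in> K" for q
    using that unfolding Q_def by (auto intro: exI[of _ 0])
  have Q: "subspace_over Q"
    unfolding subspace_over_def
  proof (intro conjI ballI allI subsetI)
    fix p q assume "p \<in> Q" "q \<in> Q"
    then obtain m n where mn: "z ^ m * p \<in> K" "z ^ n * q \<in> K"
      by (auto simp: Q_def)
    have "z ^ n * (z ^ m * p) + z ^ m * (z ^ n * q) \<in> K"
      by (rule K_add[OF K_left[OF mn(1)] K_left[OF mn(2)]])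
    then have "z ^ (n + m) * (p + q) \<in> K"
      by (simp add: distrib_left mult.assoc[symmetric] power_add[symmetric] add.commute)
    then show "p + q \<in> Q" by (auto simp: Q_def)
  qed (auto simp: Q_def intro: K_scale exI[of _ 0])
  have Q_z: "q \<in> Q" if zq: "z * q \<in> Q" for q
  proof -
    obtain n where "z ^ n * (z * q) \<in> K"
      using zq by (auto simp: Q_def)
    then have "z ^ Suc n * q \<in> K"
      by (simp add: power_Suc2 mult.assoc del: power_Suc)
    then show ?thesis unfolding Q_def by blast
  qed
  \<comment> \<open>Positive degrees are truncated to 0; words that contain them are handled by their length.\<close>
  define depth where "depth w = (\<Sum>i\<leftarrow>w. nat (- deg i))" for w
  have "basis_monomial w \<in> Q" for w
  proof (induction w rule: wf_induct_rule[OF wf_measures[of "[length, depth]"]])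
    case (1 w)
    show ?case
    proof (cases "\<exists>i\<in>set w. deg i > 0")
      case True
      then obtain u i v where "w = u @ i # v" "deg i > 0"
        by (auto simp: in_set_conv_decomp)
      then show ?thesis
        using 1 by (auto intro!: positive_letter[OF Q])
    next
      case False
      have "basis_monomial ([] @ u @ k # v) \<in> Q" if w: "w = u @ i # v" and k: "deg k = deg h + deg i" for u i v k
      proof (cases "deg k > 0")
        case True
        then show ?thesis
          using 1 w by (auto intro!: positive_letter[OF Q])
      next
        case deg_k: False
        have "deg i \<le> 0" using False w by auto
        then have "nat (- deg k) < nat (- deg i)" using deg_k k assms by simp
        then show ?thesis
          using 1 w by (simp add: depth_def)
      qed
      from commutator_mem[OF Q this] have "gen (basis h) * basis_monomial w - basis_monomial w * gen (basis h) \<in> Q"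
        by (simp add: basis_monomial_simps)
      moreover have "z * basis_monomial w - (gen (basis h) * basis_monomial w - basis_monomial w * gen (basis h)) \<in> K"
        using K_character[OF basis_sv_plus[OF assms], of "basis_monomial w"] by (simp add: z_def left_diff_distrib right_diff_distrib mult.assoc)
      ultimately have "z * basis_monomial w \<in> Q"
        by (rule subspace_over_cong[OF Q, rotated])
      then show ?thesis by (rule Q_z)
    qed
  qed
  then have "q \<in> Q" by (rule subspace_over_words[OF Q])
  then show ?thesis by (simp add: Q_def z_def)
qed

text \<open>
  On an eigenvector \<open>q\<close> with eigenvalue \<open>c\<close> the powers of the locally nilpotent operator act by powers
  of \<open>c - \<psi> x\<close>, so this number is 0.
\<close>

corollary eigenvalue_unique:
  assumes "deg h > 0" and eigen: "gen (basis h) * q - pm_scale c q \<in> K" and "q \<notin> K"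
  shows "c = \<psi> (basis h)"
proof (rule ccontr)
  assume c: "c \<noteq> \<psi> (basis h)"
  define z where "z = gen (basis h) - pm_scale (\<psi> (basis h)) 1"
  define d where "d = c - \<psi> (basis h)"
  have zq: "z * q - pm_scale d q \<in> K"
    using eigen by (simp add: z_def d_def left_diff_distrib pm.scale_left_diff_distrib)
  have "z ^ n * q - pm_scale (d ^ n) q \<in> K" for n
  proof (induction n)
    case 0
    then show ?case using K_ideal env_ideal_zero by simp
  next
    case (Suc n)
    have "z * (z ^ n * q - pm_scale (d ^ n) q) + pm_scale (d ^ n) (z * q - pm_scale d q) \<in> K"
      using Suc zq by (intro K_add K_left K_scale)
    moreover have "z * (z ^ n * q - pm_scale (d ^ n) q) + pm_scale (d ^ n) (z * q - pm_scale d q)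
        = z ^ Suc n * q - pm_scale (d ^ Suc n) q"
      by (simp add: right_diff_distrib pm.scale_right_diff_distrib mult.assoc mult.commute[of d])
    ultimately show ?case by simp
  qed
  moreover obtain n where "z ^ n * q \<in> K"
    using locally_nilpotent[OF assms(1), of q] by (auto simp: z_def)
  ultimately have "z ^ n * q + pm_scale (- 1) (z ^ n * q - pm_scale (d ^ n) q) \<in> K"
    by (intro K_add K_scale)
  then have "pm_scale (d ^ n) q \<in> K"
    by simp
  then have "pm_scale (inverse (d ^ n)) (pm_scale (d ^ n) q) \<in> K"
    by (rule K_scale)
  then have "q \<in> K" using c by (simp add: d_def)
  with \<open>q \<notin> K\<close> show False ..
qed

end

lemma bracket_M0: "bracket x (basis (Mgen 0)) = 0"
proof (induction x rule: sv_induct)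
  case (scale c i)
  have "basis_bracket i (Mgen 0) = 0"
    by (cases i) auto
  then show ?case by (simp add: bracket_linear)
qed (simp_all add: bracket_linear)

lemma M0_central: "p * gen (basis (Mgen 0)) - gen (basis (Mgen 0)) * p \<in> env_ideal UNIV"
proof (induction p rule: single_add_induct)
  case (single k c)
  let ?M = "gen (basis (Mgen 0))"
  have "monomial xs * ?M - ?M * monomial xs \<in> env_ideal UNIV" for xs
  proof (induction xs)
    case Nil
    then show ?case by (simp add: env_ideal_zero)
  next
    case (Cons x xs)
    have "gen x * ?M - ?M * gen x \<in> env_ideal UNIV"
      using env_ideal_add[OF closed_under_ops_UNIV gen_bracket[of x "basis (Mgen 0)"] gen_zero]
      by (simp add: bracket_M0)
    then have "gen x * (monomial xs * ?M - ?M * monomial xs) + (gen x * ?M - ?M * gen x) * monomial xs \<in> env_ideal UNIV"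
      using Cons by (intro env_ideal_add env_ideal_mult) simp_all
    then show ?case by (simp add: monomial_Cons left_diff_distrib right_diff_distrib mult.assoc)
  qed
  then have "scalar c * (monomial (letters k) * ?M - ?M * monomial (letters k)) \<in> env_ideal UNIV"
    by (intro env_ideal_mult) simp_all
  moreover have "Poly_Mapping.single k c = pm_scale c (monomial (letters k))"
    by (simp add: monomial_def)
  ultimately show ?case by (simp add: scalar_mult pm.scale_right_diff_distrib)
next
  case (add p q)
  let ?M = "gen (basis (Mgen 0))"
  have "(p + q) * ?M - ?M * (p + q) = (p * ?M - ?M * p) + (q * ?M - ?M * q)"
    by (simp add: distrib_left distrib_right)
  then show ?case
    using env_ideal_add[OF closed_under_ops_UNIV add] by simp
qed


section \<open>The quotient with prescribed central character\<close>

text \<open>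
  The class of \<open>p \<otimes> 1\<close>, that is, the result of applying \<open>p\<close> to the cyclic Whittaker vector.
\<close>

definition L_proj :: "(sv \<Rightarrow> complex) \<Rightarrow> complex \<Rightarrow> sv free_alg \<Rightarrow> W_elem set" where
  "L_proj \<psi> \<xi> p = ((\<lambda>w. M0_minus \<xi> \<odot>\<^bsub>W_mod \<psi>\<^esub> w) ` carrier (W_mod \<psi>)) +>\<^bsub>W_mod \<psi>\<^esub> W_proj \<psi> p"

context
  fixes \<psi> :: "sv \<Rightarrow> complex" and \<xi> :: complex
  assumes \<psi>: "lie_hom_plus \<psi>"
begin

abbreviation (input) M0_shift :: "sv free_alg" where
  "M0_shift \<equiv> gen (basis (Mgen 0)) - pm_scale \<xi> 1"

abbreviation (input) shifted :: "W_elem set" where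
  "shifted \<equiv> (\<lambda>w. M0_minus \<xi> \<odot>\<^bsub>W_mod \<psi>\<^esub> w) ` carrier (W_mod \<psi>)"

lemma shift_central: "p * M0_shift - M0_shift * p \<in> env_ideal UNIV"
  using M0_central[of p] by (simp add: left_diff_distrib right_diff_distrib)

text \<open>
  This explicit form makes the submodule property of \<open>shifted\<close> a consequence of the centrality of
  \<open>M\<^sub>0\<close> in the enveloping algebra.
\<close>

lemma mem_shifted: "w \<in> shifted \<longleftrightarrow> (\<exists>p. w = W_proj \<psi> (M0_shift * p))"
proof
  assume "w \<in> shifted"
  then obtain v where "v \<in> carrier (W_mod \<psi>)" "w = M0_minus \<xi> \<odot>\<^bsub>W_mod \<psi>\<^esub> v"
    by blast
  then show "\<exists>p. w = W_proj \<psi> (M0_shift * p)"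
    using W_proj_surj[OF \<psi>] W_proj_smult[OF \<psi>] M0_minus_eq by metis
next
  assume "\<exists>p. w = W_proj \<psi> (M0_shift * p)"
  then obtain p where "w = W_proj \<psi> (M0_shift * p)" ..
  then have "w = M0_minus \<xi> \<odot>\<^bsub>W_mod \<psi>\<^esub> W_proj \<psi> p"
    by (simp add: W_proj_smult[OF \<psi>] M0_minus_eq)
  then show "w \<in> shifted"
    using W_proj_carrier[OF \<psi>] by blast
qed

lemma W_proj_diff:
  "W_proj \<psi> p \<ominus>\<^bsub>W_mod \<psi>\<^esub> W_proj \<psi> q = W_proj \<psi> (p - q)"
proof -
  interpret abelian_group "W_mod \<psi>"
    using operator_group_W[OF \<psi>] by (simp add: operator_group_def)
  have "W_proj \<psi> (p - q) \<oplus>\<^bsub>W_mod \<psi>\<^esub> W_proj \<psi> q = W_proj \<psi> p"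
    using W_proj_add[OF \<psi>, of "p - q" q] by simp
  then show ?thesis
    using W_proj_carrier[OF \<psi>] by (metis add.inv_solve_right' minus_eq)
qed

lemma operator_subgroup_shifted: "operator_subgroup (carrier U_sv) (W_mod \<psi>) shifted"
proof (rule operator_subgroup.intro)
  show "operator_group (carrier U_sv) (W_mod \<psi>)"
    by (rule operator_group_W[OF \<psi>])
  interpret abelian_group "W_mod \<psi>"
    using operator_group_W[OF \<psi>] by (simp add: operator_group_def)
  have zero: "\<zero>\<^bsub>W_mod \<psi>\<^esub> = W_proj \<psi> 0"
    using W_proj_diff[of 0 0] W_proj_carrier[OF \<psi>] by (metis diff_zero minus_eq r_neg)
  have "subgroup shifted (add_monoid (W_mod \<psi>))"
  proof (rule add.subgroupI)
    show "shifted \<subseteq> carrier (W_mod \<psi>)"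
    proof
      fix w assume "w \<in> shifted"
      then show "w \<in> carrier (W_mod \<psi>)"
        unfolding mem_shifted using W_proj_carrier[OF \<psi>] by auto
    qed
    have "W_proj \<psi> (M0_shift * 0) \<in> shifted"
      unfolding mem_shifted by (rule exI) (rule refl)
    then show "shifted \<noteq> {}"
      by (metis empty_iff)
    show "\<ominus>\<^bsub>W_mod \<psi>\<^esub> w \<in> shifted" if w: "w \<in> shifted" for w
    proof -
      obtain p where p: "w = W_proj \<psi> (M0_shift * p)"
        using w unfolding mem_shifted by (rule exE)
      have "\<ominus>\<^bsub>W_mod \<psi>\<^esub> w = \<zero>\<^bsub>W_mod \<psi>\<^esub> \<ominus>\<^bsub>W_mod \<psi>\<^esub> w"
        using p W_proj_carrier[OF \<psi>] by (simp add: minus_eq)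
      also have "\<dots> = W_proj \<psi> (M0_shift * (- p))"
        by (simp add: zero p W_proj_diff)
      finally show ?thesis unfolding mem_shifted by (rule exI)
    qed
    show "v \<oplus>\<^bsub>W_mod \<psi>\<^esub> w \<in> shifted" if vw: "v \<in> shifted" "w \<in> shifted" for v w
    proof -
      obtain p q where "v = W_proj \<psi> (M0_shift * p)" "w = W_proj \<psi> (M0_shift * q)"
        using vw unfolding mem_shifted by (elim exE)
      then have "v \<oplus>\<^bsub>W_mod \<psi>\<^esub> w = W_proj \<psi> (M0_shift * (p + q))"
        by (simp add: W_proj_add[OF \<psi>] distrib_left)
      then show ?thesis unfolding mem_shifted by (rule exI)
    qed
  qed
  then show "additive_subgroup shifted (W_mod \<psi>)"
    by (rule additive_subgroup.intro)
  fix X w assume "X \<in> carrier U_sv" "w \<in> shifted"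
  then obtain s p where X: "X = env_class UNIV s" and w: "w = W_proj \<psi> (M0_shift * p)"
    unfolding mem_shifted carrier_U_sv by (elim exE)
  have "(s * M0_shift - M0_shift * s) * p \<in> env_ideal UNIV"
    using shift_central[of s] by (intro env_ideal_mult) simp_all
  then have "W_proj \<psi> (s * (M0_shift * p)) = W_proj \<psi> (M0_shift * (s * p))"
    by (intro W_proj_eqI[OF \<psi>]) (simp add: left_diff_distrib mult.assoc)
  then have "X \<odot>\<^bsub>W_mod \<psi>\<^esub> w = W_proj \<psi> (M0_shift * (s * p))"
    by (simp add: X w W_proj_smult[OF \<psi>])
  then show "X \<odot>\<^bsub>W_mod \<psi>\<^esub> w \<in> shifted"
    unfolding mem_shifted by (rule exI)
qed

interpretation L: operator_subgroup "carrier U_sv" "W_mod \<psi>" shifted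
  by (rule operator_subgroup_shifted)

lemma carrier_L: "carrier (L_mod \<psi> \<xi>) = range (L_proj \<psi> \<xi>)"
proof -
  have "carrier (W_mod \<psi>) = range (W_proj \<psi>)"
    using W_proj_carrier[OF \<psi>] W_proj_surj[OF \<psi>] by blast
  then have "(+>\<^bsub>W_mod \<psi>\<^esub>) shifted ` carrier (W_mod \<psi>) = (\<lambda>p. shifted +>\<^bsub>W_mod \<psi>\<^esub> W_proj \<psi> p) ` UNIV"
    by (metis image_image)
  moreover have "L_proj \<psi> \<xi> = (\<lambda>p. shifted +>\<^bsub>W_mod \<psi>\<^esub> W_proj \<psi> p)"
    by (rule ext) (rule L_proj_def)
  ultimately show ?thesis
    by (simp only: L_mod_def L.carrier_quot)
qed

lemma L_proj_add: "L_proj \<psi> \<xi> (p + q) = L_proj \<psi> \<xi> p \<oplus>\<^bsub>L_mod \<psi> \<xi>\<^esub> L_proj \<psi> \<xi> q"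
  unfolding L_proj_def L_mod_def W_proj_add[OF \<psi>]
  by (rule L.add_quot[symmetric]) (rule W_proj_carrier[OF \<psi>])+

lemma L_proj_smult: "env_class UNIV s \<odot>\<^bsub>L_mod \<psi> \<xi>\<^esub> L_proj \<psi> \<xi> p = L_proj \<psi> \<xi> (s * p)"
  unfolding L_proj_def L_mod_def W_proj_smult[OF \<psi>, symmetric]
  by (rule L.smult_quot) (simp_all add: W_proj_carrier[OF \<psi>])

lemma L_proj_eq_iff:
  "L_proj \<psi> \<xi> p = L_proj \<psi> \<xi> q \<longleftrightarrow> (\<exists>r. W_proj \<psi> (p - q) = W_proj \<psi> (M0_shift * r))"
  unfolding L_proj_def
  using L.coset_eq_iff[OF W_proj_carrier[OF \<psi>] W_proj_carrier[OF \<psi>], of p q] mem_shifted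
  by (simp only: W_proj_diff)

lemma L_proj_eqI: "W_proj \<psi> p = W_proj \<psi> q \<Longrightarrow> L_proj \<psi> \<xi> p = L_proj \<psi> \<xi> q"
  by (simp add: L_proj_def)

lemma L_proj_M0: "L_proj \<psi> \<xi> (p * M0_shift) = L_proj \<psi> \<xi> 0"
proof -
  have "W_proj \<psi> (p * M0_shift - 0) = W_proj \<psi> (M0_shift * p)"
    using shift_central[of p] by (intro W_proj_eqI[OF \<psi>]) simp
  then show ?thesis unfolding L_proj_eq_iff by blast
qed

text \<open>
  Otherwise \<open>1\<close> and a multiple of \<open>M\<^sub>0 - \<xi>\<close> have the same class in \<open>W_mod\<close>, but the Whittaker
  functional is 1 on the former and 0 on the latter.
\<close>

lemma L_proj_one: "L_proj \<psi> \<xi> 1 \<noteq> L_proj \<psi> \<xi> 0"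
proof
  assume "L_proj \<psi> \<xi> 1 = L_proj \<psi> \<xi> 0"
  then obtain r where r: "W_proj \<psi> 1 = W_proj \<psi> (M0_shift * r)"
    unfolding L_proj_eq_iff diff_zero by (elim exE)
  show False
  proof (rule whittaker_functional[OF \<psi>, where \<xi> = \<xi>])
    fix \<Phi> :: "sv free_alg \<Rightarrow> complex"
    assume \<Phi>: "\<And>p q. \<Phi> (p + q) = \<Phi> p + \<Phi> q" "\<And>c p. \<Phi> (pm_scale c p) = c * \<Phi> p" "\<Phi> 1 = 1"
      "\<And>p. p \<in> env_ideal UNIV \<Longrightarrow> \<Phi> p = 0"
      "\<And>p x. x \<in> sv_plus \<Longrightarrow> \<Phi> (p * gen x) = \<psi> x * \<Phi> p"
      "\<And>p. \<Phi> (p * gen (basis (Mgen 0))) = \<xi> * \<Phi> p"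
    have diff: "\<Phi> (p - q) = \<Phi> p - \<Phi> q" for p q
      by (rule additive_diff) (rule \<Phi>(1))
    have "\<Phi> 1 = \<Phi> (M0_shift * r)"
      by (rule W_proj_functional[where \<Phi> = \<Phi>, OF \<psi> \<Phi>(1,2,4,5) r])
    also have "\<dots> = \<Phi> (r * M0_shift)"
      using \<Phi>(4)[OF shift_central[of r]] by (simp add: diff)
    also have "\<dots> = 0"
      by (simp add: right_diff_distrib diff \<Phi>(2,6))
    finally show False using \<Phi>(3) by simp
  qed
qed

definition L_kernel :: "sv free_alg set" where
  "L_kernel = {p. L_proj \<psi> \<xi> p = L_proj \<psi> \<xi> 0}"

lemma L_proj_eq_kernel: "L_proj \<psi> \<xi> p = L_proj \<psi> \<xi> q \<longleftrightarrow> p - q \<in> L_kernel"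
  unfolding L_kernel_def mem_Collect_eq L_proj_eq_iff by simp

lemma whittaker_kernel_L: "whittaker_kernel \<psi> L_kernel"
proof
  show "p + q \<in> L_kernel" if "p \<in> L_kernel" "q \<in> L_kernel" for p q
  proof -
    have "L_proj \<psi> \<xi> (p + q) = L_proj \<psi> \<xi> (0 + 0)"
      using that unfolding L_kernel_def mem_Collect_eq L_proj_add by (simp only:)
    then show ?thesis by (simp add: L_kernel_def)
  qed
  show "s * p \<in> L_kernel" if "p \<in> L_kernel" for s p
  proof -
    have "L_proj \<psi> \<xi> (s * p) = L_proj \<psi> \<xi> (s * 0)"
      using that unfolding L_kernel_def mem_Collect_eq L_proj_smult[symmetric] by (simp only:)
    then show ?thesis by (simp add: L_kernel_def)
  qed
  show "p \<in> L_kernel" if "p \<in> env_ideal UNIV" for p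
    using L_proj_eqI[OF W_proj_eqI[OF \<psi>, of p 0]] that by (simp add: L_kernel_def)
  show "p * gen x - pm_scale (\<psi> x) p \<in> L_kernel" if "x \<in> sv_plus" for p x
    using L_proj_eqI[OF W_proj_character[OF \<psi> that, of p]] unfolding L_proj_eq_kernel .
qed

end

section \<open>The isomorphism theorem\<close>

lemma lie_hom_plus_eqI:
  assumes "lie_hom_plus \<psi>1" "lie_hom_plus \<psi>2"
    and "\<And>i. deg i > 0 \<Longrightarrow> \<psi>1 (basis i) = \<psi>2 (basis i)" and "x \<in> sv_plus"
  shows "\<psi>1 x = \<psi>2 x"
  using assms(4)
  by (induction rule: sv_plus_induct)
    (use assms(3) in \<open>simp_all add: lie_hom_plus_zero[OF assms(1)] lie_hom_plus_zero[OF assms(2)]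
      lie_hom_plus_step[OF assms(1)] lie_hom_plus_step[OF assms(2)]\<close>)

text \<open>
  Let \<open>q\<close> represent the image of the first Whittaker vector. Any \<open>x\<close> that acts by a scalar \<open>c\<close> on the
  first Whittaker vector acts by \<open>c\<close> on \<open>q\<close>; this is applied to the basis of \<open>sv_plus\<close> and to \<open>M\<^sub>0\<close>.
\<close>

theorem L_mod_iso_imp_eq:
  assumes \<psi>1: "lie_hom_plus \<psi>1" and \<psi>2: "lie_hom_plus \<psi>2"
    and iso: "sv_iso (L_mod \<psi>1 \<xi>1) (L_mod \<psi>2 \<xi>2)"
  shows "(\<forall>x\<in>sv_plus. \<psi>1 x = \<psi>2 x) \<and> \<xi>1 = \<xi>2"
proof -
  let ?M = "gen (basis (Mgen 0))"
  define K1 where "K1 = L_kernel \<psi>1 \<xi>1"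
  define K2 where "K2 = L_kernel \<psi>2 \<xi>2"
  interpret K1: whittaker_kernel \<psi>1 K1
    unfolding K1_def by (rule whittaker_kernel_L[OF \<psi>1])
  interpret K2: whittaker_kernel \<psi>2 K2
    unfolding K2_def by (rule whittaker_kernel_L[OF \<psi>2])
  let ?p1 = "L_proj \<psi>1 \<xi>1" and ?p2 = "L_proj \<psi>2 \<xi>2"
  have eq1: "?p1 p = ?p1 q \<longleftrightarrow> p - q \<in> K1" for p q
    unfolding K1_def by (rule L_proj_eq_kernel[OF \<psi>1])
  have eq2: "?p2 p = ?p2 q \<longleftrightarrow> p - q \<in> K2" for p q
    unfolding K2_def by (rule L_proj_eq_kernel[OF \<psi>2])
  obtain f where bij: "bij_betw f (carrier (L_mod \<psi>1 \<xi>1)) (carrier (L_mod \<psi>2 \<xi>2))"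
    and f_scalar: "\<And>c p. f (env_scalar UNIV c \<odot>\<^bsub>L_mod \<psi>1 \<xi>1\<^esub> ?p1 p) = env_scalar UNIV c \<odot>\<^bsub>L_mod \<psi>2 \<xi>2\<^esub> f (?p1 p)"
    and f_gen: "\<And>x p. f (env_gen UNIV x \<odot>\<^bsub>L_mod \<psi>1 \<xi>1\<^esub> ?p1 p) = env_gen UNIV x \<odot>\<^bsub>L_mod \<psi>2 \<xi>2\<^esub> f (?p1 p)"
    using iso unfolding sv_iso_def iso_def carrier_L[OF \<psi>1] by auto
  have "f (?p1 p) \<in> range ?p2" for p
    using bij_betwE[OF bij] unfolding carrier_L[OF \<psi>1] carrier_L[OF \<psi>2] by (rule bspec) (rule rangeI)
  then have "\<forall>p. \<exists>r. f (?p1 p) = ?p2 r"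
    by (simp add: image_iff)
  then obtain g where "\<forall>p. f (?p1 p) = ?p2 (g p)"
    by (rule choice[THEN exE])
  then have g: "f (?p1 p) = ?p2 (g p)" for p
    by (rule spec)
  define q where "q = g 1"
  have f_scale: "f (?p1 (pm_scale c p)) = ?p2 (pm_scale c (g p))" for c p
    using f_scalar[of c p] by (simp add: env_scalar_def g L_proj_smult[OF \<psi>1] L_proj_smult[OF \<psi>2])
  have f_mult: "f (?p1 (gen x * p)) = ?p2 (gen x * g p)" for x p
    using f_gen[of x p] by (simp add: env_gen_def g L_proj_smult[OF \<psi>1] L_proj_smult[OF \<psi>2])
  have "q \<notin> K2"
  proof
    assume "q \<in> K2"
    then have "f (?p1 1) = ?p2 0"
      using eq2[of q 0] by (simp add: g q_def)
    moreover have "f (?p1 0) = ?p2 0"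
      using f_scale[of 0 1] by simp
    ultimately have "f (?p1 1) = f (?p1 0)"
      by simp
    then have "?p1 1 = ?p1 0"
      by (rule inj_onD[OF bij_betw_imp_inj_on[OF bij]]) (simp_all add: carrier_L[OF \<psi>1])
    then show False
      using L_proj_one[OF \<psi>1] by blast
  qed
  have eigen: "gen x * q - pm_scale c q \<in> K2" if "gen x - pm_scale c 1 \<in> K1" for x c
  proof -
    have "?p1 (gen x * 1) = ?p1 (pm_scale c 1)"
      using that by (simp add: eq1)
    then have "?p2 (gen x * q) = ?p2 (pm_scale c q)"
      unfolding q_def by (metis f_mult f_scale)
    then show ?thesis by (simp add: eq2)
  qed
  have "\<psi>1 (basis i) = \<psi>2 (basis i)" if i: "deg i > 0" for i
  proof (rule K2.eigenvalue_unique[OF i eigen \<open>q \<notin> K2\<close>])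
    show "gen (basis i) - pm_scale (\<psi>1 (basis i)) 1 \<in> K1"
      using K1.K_character[OF basis_sv_plus[OF i], of 1] by simp
  qed
  then have "\<forall>x\<in>sv_plus. \<psi>1 x = \<psi>2 x"
    using lie_hom_plus_eqI[OF \<psi>1 \<psi>2] by blast
  moreover have "\<xi>1 = \<xi>2"
  proof (rule ccontr)
    assume "\<xi>1 \<noteq> \<xi>2"
    have "?M - pm_scale \<xi>1 1 \<in> K1"
      using L_proj_M0[OF \<psi>1, of \<xi>1 1] by (simp add: eq1)
    then have 1: "?M * q - pm_scale \<xi>1 q \<in> K2"
      by (rule eigen)
    have 2: "q * ?M - pm_scale \<xi>2 q \<in> K2"
      using L_proj_M0[OF \<psi>2, of \<xi>2 q] by (simp add: eq2 right_diff_distrib)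
    have 3: "q * ?M - ?M * q \<in> K2"
      by (intro K2.K_ideal M0_central)
    have "(q * ?M - pm_scale \<xi>2 q) + pm_scale (- 1) ((q * ?M - ?M * q) + (?M * q - pm_scale \<xi>1 q)) \<in> K2"
      by (rule K2.K_add[OF 2 K2.K_scale[OF K2.K_add[OF 3 1]]])
    then have "pm_scale (\<xi>1 - \<xi>2) q \<in> K2"
      by (simp add: pm.scale_left_diff_distrib)
    then have "pm_scale (inverse (\<xi>1 - \<xi>2)) (pm_scale (\<xi>1 - \<xi>2) q) \<in> K2"
      by (rule K2.K_scale)
    then show False
      using \<open>\<xi>1 \<noteq> \<xi>2\<close> \<open>q \<notin> K2\<close> by simp
  qed
  ultimately show ?thesis ..
qed

lemma psi_ext_cong:
  assumes "\<And>x. x \<in> S \<Longrightarrow> \<psi>1 x = \<psi>2 x" "p \<in> carrier (free_alg S)"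
  shows "psi_ext \<psi>1 p = psi_ext \<psi>2 p"
proof -
  have "map \<psi>1 (letters w) = map \<psi>2 (letters w)" if "w \<in> Poly_Mapping.keys p" for w
    using assms that by (auto simp: carrier_free_alg)
  then show ?thesis
    unfolding psi_ext_def by (intro sum.cong refl) (simp only:)
qed

lemma tensor_rels_mono:
  assumes \<psi>1: "lie_hom_plus \<psi>1" and \<psi>2: "lie_hom_plus \<psi>2"
    and eq: "\<And>x. x \<in> sv_plus \<Longrightarrow> \<psi>1 x = \<psi>2 x"
  shows "tensor_rels U_sv_plus U_sv env_incl (C_mod \<psi>1) \<subseteq> tensor_rels U_sv_plus U_sv env_incl (C_mod \<psi>2)"
proof
  fix r assume "r \<in> tensor_rels U_sv_plus U_sv env_incl (C_mod \<psi>1)"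
  then show "r \<in> tensor_rels U_sv_plus U_sv env_incl (C_mod \<psi>2)"
  proof (cases rule: tensor_rels_cases[OF \<psi>1, consumes 1, case_names left right balance])
    case (balance p h \<alpha>)
    then show ?thesis
      using tensor_rels_intros(3)[OF \<psi>2 balance(1), of p \<alpha>] psi_ext_cong[OF eq balance(1)] by simp
  qed (simp_all only: tensor_rels_intros[OF \<psi>2])
qed

lemma W_mod_cong:
  assumes "lie_hom_plus \<psi>1" "lie_hom_plus \<psi>2"
    and "\<And>x. x \<in> sv_plus \<Longrightarrow> \<psi>1 x = \<psi>2 x"
  shows "W_mod \<psi>1 = W_mod \<psi>2"
proof -
  have "tensor_rels U_sv_plus U_sv env_incl (C_mod \<psi>1) = tensor_rels U_sv_plus U_sv env_incl (C_mod \<psi>2)"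
    using tensor_rels_mono[of \<psi>1 \<psi>2] tensor_rels_mono[of \<psi>2 \<psi>1] assms by (intro equalityI) simp_all
  moreover have "pretensor U_sv (C_mod \<psi>1) = pretensor U_sv (C_mod \<psi>2)"
    by (simp add: pretensor_def)
  ultimately show ?thesis
    by (simp add: W_mod_def tensor_def)
qed

lemma sv_iso_refl: "sv_iso V V"
proof -
  have "(\<lambda>v. v) \<in> iso (add_monoid V) (add_monoid V)"
    by (simp add: iso_def hom_def bij_betw_def)
  then show ?thesis
    unfolding sv_iso_def by (rule bexI[rotated]) simp
qed

theorem theorem3p8:
  fixes \<psi>1 \<psi>2 :: "sv \<Rightarrow> complex" and \<xi>1 \<xi>2 :: complex
  assumes "admissible \<psi>1" and "admissible \<psi>2"
    and "nonsingular \<psi>1" and "nonsingular \<psi>2"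
  shows "sv_iso (L_mod \<psi>1 \<xi>1) (L_mod \<psi>2 \<xi>2) \<longleftrightarrow>
    (\<forall>x\<in>sv_plus. \<psi>1 x = \<psi>2 x) \<and> \<xi>1 = \<xi>2"
proof
  have \<psi>: "lie_hom_plus \<psi>1" "lie_hom_plus \<psi>2"
    using assms by (auto simp: admissible_def)
  show "(\<forall>x\<in>sv_plus. \<psi>1 x = \<psi>2 x) \<and> \<xi>1 = \<xi>2" if "sv_iso (L_mod \<psi>1 \<xi>1) (L_mod \<psi>2 \<xi>2)"
    using L_mod_iso_imp_eq[OF \<psi> that] .
  assume "(\<forall>x\<in>sv_plus. \<psi>1 x = \<psi>2 x) \<and> \<xi>1 = \<xi>2"
  then have "L_mod \<psi>1 \<xi>1 = L_mod \<psi>2 \<xi>2"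
    using W_mod_cong[OF \<psi>] by (simp add: L_mod_def)
  then show "sv_iso (L_mod \<psi>1 \<xi>1) (L_mod \<psi>2 \<xi>2)"
    by (simp add: sv_iso_refl)
qed

end
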